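(* Let $\psi:\mathcal C_2\to\mathcal P$ be defined by $\psi(C(p,q))=(\sqrt{q^2-p^2},p,q)$ if $2\mid p$ and $\psi(C(p,q))=(p,\sqrt{q^2-p^2},q)$ if $2\nmid p$. Then $\psi$ is a bijection; the map $\varphi:\mathcal P\to H'$, $\varphi(x,y,z)=$ the element $M\in H'$ with $M(1,0,1)^t=(x,y,z)^t$, is a well-defined bijection; and the binary operation on $\mathcal C_2$ $$C(p_1,q_1)*C(p_2,q_2)=\psi^{-1}\big(\varphi\psi(C(p_1,q_1))\,\varphi\psi(C(p_2,q_2))\,(1,0,1)^t\big)$$ makes $\mathcal C_2$ a free, non-commutative, infinitely generated monoid with identity $C(1,1)$ (the class of orthogonal well-rounded lattices), and $\varphi\psi:(\mathcal C_2,* )\to H'$ is a monoid isomorphism. Its Cayley digraph with respect to a free generating set is a regular rooted infinite tree in which every vertex has infinite degree.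
   Context: All lattices are full-rank lattices in $\mathbb R^2$. For a lattice $\Lambda$, $|\Lambda|=\min_{x\in\Lambda\setminus\{0\}}\|x\|$ (Euclidean norm) and $S(\Lambda)=\{x\in\Lambda:\|x\|=|\Lambda|\}$; $\Lambda$ is well-rounded (WR) if $S(\Lambda)$ spans $\mathbb R^2$. $\mathrm{WR}(\mathbb Z^2)$ is the set of full-rank WR sublattices of $\mathbb Z^2$. For a WR lattice $\Lambda$, $\theta(\Lambda)\in[\pi/3,\pi/2]$ is the angle between two linearly independent minimal vectors chosen so that the angle is at most $\pi/2$; equivalently $\sin\theta(\Lambda)=\det(\Lambda)/|\Lambda|^2$. For $q\in\mathbb Z_{>0}$ let $\mathcal S_q=\{p/q\in\mathbb Q\cap(\sqrt3/2,1):\gcd(p,q)=1,\ \sqrt{q^2-p^2}\in\mathbb Z\}$ and $\mathcal S=\bigcup_{q}\mathcal S_q\cup\{1\}$, where $1$ is written as $p/q$ with $p=q=1$; elements of $\mathcal S$ are written in lowest terms. For $p/q\in\mathcal S$, $C(p,q)=\{\Lambda\in\mathrm{WR}(\mathbb Z^2):\sin\theta(\Lambda)=p/q\}$, and $\mathcal C_2=\{C(p,q):p/q\in\mathcal S\}$ (these are exactly the similarity classes of lattices in $\mathrm{WR}(\mathbb Z^2)$). Let $\mathfrak P=\{(x,y,z)\in\mathbb Z_{>0}^3: 2\mid y,\ \gcd(x,y,z)=1,\ x^2+y^2=z^2\}$ and $\mathcal P=\{(x,y,z)\in\mathfrak P:\min\{x,y\}<z/2\}\cup\{(1,0,1)\}$.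 Let $A=\begin{pmatrix}1&-2&2\\2&-1&2\\2&-2&3\end{pmatrix}$, $B=\begin{pmatrix}1&2&2\\2&1&2\\2&2&3\end{pmatrix}$, $C=\begin{pmatrix}-1&2&2\\-2&1&2\\-2&2&3\end{pmatrix}$, and let $G$ be the monoid of $3\times3$ matrices generated by $I_3,A,B,C$ under multiplication, acting on triples viewed as column vectors. Let $H$ be the set of all matrices of the forms $A^2NB$, $A^kB$, $ABNB$, $C^2NB$, $C^kB$, $CBNB$, $(AC)^kA^2NB$, $(AC)^kABNB$, $(AC)^kAB$, $(CA)^kC^2NB$, $(CA)^kCBNB$, $(CA)^kCB$, with $N\in G$ and $k\in\mathbb Z_{>0}$, and $H'=H\cup\{I_3\}$ (a submonoid of $G$). *)

theory Defs
  imports "HOL-Analysis.Analysis" "HOL-Library.Equipollence"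
begin

section \<open>Planar lattices (points of R^2 modelled as real \<times> real, Euclidean norm)\<close>

definition full_rank_lattice :: "(real \<times> real) set \<Rightarrow> bool" where
  "full_rank_lattice L \<longleftrightarrow>
     (\<exists>u v. independent {u, v} \<and> u \<noteq> v \<and>
        L = {of_int m *\<^sub>R u + of_int n *\<^sub>R v | m n. True})"

definition lattice_min :: "(real \<times> real) set \<Rightarrow> real" where
  "lattice_min L = Inf {norm x | x. x \<in> L \<and> x \<noteq> 0}"

definition min_vectors :: "(real \<times> real) set \<Rightarrow> (real \<times> real) set" where
  "min_vectors L = {x \<in> L. norm x = lattice_min L}"

definition well_rounded :: "(real \<times> real) set \<Rightarrow> bool" where
  "well_rounded L \<longleftrightarrow> span (min_vectors L) = UNIV"

text \<open>Full-rank WR sublattices of Z^2.\<close>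
definition WR_Z2 :: "(real \<times> real) set set" where
  "WR_Z2 = {L. full_rank_lattice L \<and> well_rounded L \<and>
              L \<subseteq> {(of_int a, of_int b) | a b. True}}"

definition vec_angle :: "real \<times> real \<Rightarrow> real \<times> real \<Rightarrow> real" where
  "vec_angle u v = arccos (inner u v / (norm u * norm v))"

text \<open>theta(L): angle between two linearly independent minimal vectors, chosen to be at most pi/2.\<close>
definition lattice_theta :: "(real \<times> real) set \<Rightarrow> real" where
  "lattice_theta L = (THE t. \<exists>u\<in>min_vectors L. \<exists>v\<in>min_vectors L.
       independent {u, v} \<and> u \<noteq> v \<and> t = vec_angle u v \<and> t \<le> pi / 2)"

section \<open>The set S and the classes C(p,q)\<close>

text \<open>Elements p/q of S, in lowest terms, as pairs (p,q).\<close>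
definition S_pairs :: "(nat \<times> nat) set" where
  "S_pairs = {(p, q). 0 < p \<and> 0 < q \<and> coprime p q \<and>
                sqrt 3 / 2 < real p / real q \<and> real p / real q < 1 \<and>
                (\<exists>r::nat. q\<^sup>2 - p\<^sup>2 = r\<^sup>2)} \<union> {(1, 1)}"

definition Cls :: "nat \<Rightarrow> nat \<Rightarrow> (real \<times> real) set set" where
  "Cls p q = {L \<in> WR_Z2. sin (lattice_theta L) = real p / real q}"

definition C2 :: "(real \<times> real) set set set" where
  "C2 = {Cls p q | p q. (p, q) \<in> S_pairs}"

section \<open>Primitive Pythagorean triples\<close>

definition PPT :: "(int \<times> int \<times> int) set" where
  "PPT = {(x, y, z). 0 < x \<and> 0 < y \<and> 0 < z \<and> even y \<and> gcd x (gcd y z) = 1 \<and>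
                     x\<^sup>2 + y\<^sup>2 = z\<^sup>2}"

definition PP :: "(int \<times> int \<times> int) set" where
  "PP = {(x, y, z) \<in> PPT. 2 * min x y < z} \<union> {(1, 0, 1)}"

section \<open>Matrices\<close>

definition vec3 :: "int \<times> int \<times> int \<Rightarrow> int ^ 3" where
  "vec3 t = (case t of (x, y, z) \<Rightarrow> (\<chi> i. if i = 1 then x else if i = 2 then y else z))"

definition unvec3 :: "int ^ 3 \<Rightarrow> int \<times> int \<times> int" where
  "unvec3 w = (w $ 1, w $ 2, w $ 3)"

definition mat3 :: "int \<times> int \<times> int \<Rightarrow> int \<times> int \<times> int \<Rightarrow> int \<times> int \<times> int \<Rightarrow> int ^ 3 ^ 3" where
  "mat3 r1 r2 r3 = (\<chi> i. if i = 1 then vec3 r1 else if i = 2 then vec3 r2 else vec3 r3)"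

definition MA :: "int ^ 3 ^ 3" where "MA = mat3 (1, -2, 2) (2, -1, 2) (2, -2, 3)"
definition MB :: "int ^ 3 ^ 3" where "MB = mat3 (1, 2, 2) (2, 1, 2) (2, 2, 3)"
definition MC :: "int ^ 3 ^ 3" where "MC = mat3 (-1, 2, 2) (-2, 1, 2) (-2, 2, 3)"

primrec mpow :: "int ^ 3 ^ 3 \<Rightarrow> nat \<Rightarrow> int ^ 3 ^ 3" where
  "mpow M 0 = mat 1"
| "mpow M (Suc k) = M ** mpow M k"

inductive_set Gmon :: "(int ^ 3 ^ 3) set" where
  id: "mat 1 \<in> Gmon"
| mulA: "M \<in> Gmon \<Longrightarrow> M ** MA \<in> Gmon"
| mulB: "M \<in> Gmon \<Longrightarrow> M ** MB \<in> Gmon"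
| mulC: "M \<in> Gmon \<Longrightarrow> M ** MC \<in> Gmon"

definition Hset :: "(int ^ 3 ^ 3) set" where
  "Hset = {M. \<exists>N\<in>Gmon. \<exists>k::nat. 0 < k \<and>
     (M = MA ** MA ** N ** MB \<or> M = mpow MA k ** MB \<or> M = MA ** MB ** N ** MB \<or>
      M = MC ** MC ** N ** MB \<or> M = mpow MC k ** MB \<or> M = MC ** MB ** N ** MB \<or>
      M = mpow (MA ** MC) k ** MA ** MA ** N ** MB \<or>
      M = mpow (MA ** MC) k ** MA ** MB ** N ** MB \<or>
      M = mpow (MA ** MC) k ** MA ** MB \<or>
      M = mpow (MC ** MA) k ** MC ** MC ** N ** MB \<or>
      M = mpow (MC ** MA) k ** MC ** MB ** N ** MB \<or>
      M = mpow (MC ** MA) k ** MC ** MB)}"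

definition H' :: "(int ^ 3 ^ 3) set" where
  "H' = Hset \<union> {mat 1}"

section \<open>The maps psi, phi and the operation on C2\<close>

definition psi :: "(real \<times> real) set set \<Rightarrow> int \<times> int \<times> int" where
  "psi c = (THE t. \<exists>p q. (p, q) \<in> S_pairs \<and> c = Cls p q \<and>
      t = (if even p then (floor (sqrt (real q ^ 2 - real p ^ 2)), int p, int q)
           else (int p, floor (sqrt (real q ^ 2 - real p ^ 2)), int q)))"

definition phi :: "int \<times> int \<times> int \<Rightarrow> int ^ 3 ^ 3" where
  "phi t = (THE M. M \<in> H' \<and> M *v vec3 (1, 0, 1) = vec3 t)"

definition cstar :: "(real \<times> real) set set \<Rightarrow> (real \<times> real) set set \<Rightarrow> (real \<times> real) set set" where
  "cstar c1 c2 = the_inv_into C2 psi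
      (unvec3 ((phi (psi c1) ** phi (psi c2)) *v vec3 (1, 0, 1)))"

section \<open>Monoid-theoretic and graph-theoretic notions\<close>

text \<open>Product of a word (list) in a monoid with operation f and unit e.\<close>
definition word_prod :: "('a \<Rightarrow> 'a \<Rightarrow> 'a) \<Rightarrow> 'a \<Rightarrow> 'a list \<Rightarrow> 'a" where
  "word_prod f e xs = foldr f xs e"

definition is_monoid :: "'a set \<Rightarrow> ('a \<Rightarrow> 'a \<Rightarrow> 'a) \<Rightarrow> 'a \<Rightarrow> bool" where
  "is_monoid M f e \<longleftrightarrow> e \<in> M \<and> (\<forall>a\<in>M. \<forall>b\<in>M. f a b \<in> M) \<and>
     (\<forall>a\<in>M. \<forall>b\<in>M. \<forall>c\<in>M. f (f a b) c = f a (f b c)) \<and>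
     (\<forall>a\<in>M. f e a = a \<and> f a e = a)"

definition generates :: "'a set \<Rightarrow> ('a \<Rightarrow> 'a \<Rightarrow> 'a) \<Rightarrow> 'a \<Rightarrow> 'a set \<Rightarrow> bool" where
  "generates M f e X \<longleftrightarrow> X \<subseteq> M \<and>
     (\<forall>a\<in>M. \<exists>xs. set xs \<subseteq> X \<and> word_prod f e xs = a)"

text \<open>X is a free basis: every element is the product of a unique word over X.\<close>
definition free_basis :: "'a set \<Rightarrow> ('a \<Rightarrow> 'a \<Rightarrow> 'a) \<Rightarrow> 'a \<Rightarrow> 'a set \<Rightarrow> bool" where
  "free_basis M f e X \<longleftrightarrow> X \<subseteq> M \<and>
     (\<forall>a\<in>M. \<exists>!xs. set xs \<subseteq> X \<and> word_prod f e xs = a)"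

definition free_monoid :: "'a set \<Rightarrow> ('a \<Rightarrow> 'a \<Rightarrow> 'a) \<Rightarrow> 'a \<Rightarrow> bool" where
  "free_monoid M f e \<longleftrightarrow> is_monoid M f e \<and> (\<exists>X. free_basis M f e X)"

definition infinitely_generated :: "'a set \<Rightarrow> ('a \<Rightarrow> 'a \<Rightarrow> 'a) \<Rightarrow> 'a \<Rightarrow> bool" where
  "infinitely_generated M f e \<longleftrightarrow> \<not> (\<exists>F. finite F \<and> generates M f e F)"

definition monoid_iso ::
  "'a set \<Rightarrow> ('a \<Rightarrow> 'a \<Rightarrow> 'a) \<Rightarrow> 'a \<Rightarrow> 'b set \<Rightarrow> ('b \<Rightarrow> 'b \<Rightarrow> 'b) \<Rightarrow> 'b \<Rightarrow> ('a \<Rightarrow> 'b) \<Rightarrow> bool" where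
  "monoid_iso M f e N g u h \<longleftrightarrow> bij_betw h M N \<and> h e = u \<and>
     (\<forall>a\<in>M. \<forall>b\<in>M. h (f a b) = g (h a) (h b))"

text \<open>Cayley digraph of (M,f) w.r.t. X: edge a -> f a x for x in X.\<close>
definition cayley_edges :: "'a set \<Rightarrow> ('a \<Rightarrow> 'a \<Rightarrow> 'a) \<Rightarrow> 'a set \<Rightarrow> ('a \<times> 'a) set" where
  "cayley_edges M f X = {(a, f a x) | a x. a \<in> M \<and> x \<in> X}"

definition out_nbrs :: "('a \<times> 'a) set \<Rightarrow> 'a \<Rightarrow> 'a set" where
  "out_nbrs E v = {w. (v, w) \<in> E}"

text \<open>Rooted (directed) tree with root r: every vertex is reachable from r,
  r has no incoming edge and every other vertex has exactly one incoming edge.\<close>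
definition rooted_tree :: "'a set \<Rightarrow> ('a \<times> 'a) set \<Rightarrow> 'a \<Rightarrow> bool" where
  "rooted_tree V E r \<longleftrightarrow> r \<in> V \<and> E \<subseteq> V \<times> V \<and>
     (\<forall>v\<in>V. (r, v) \<in> E\<^sup>*) \<and> (\<forall>v. (v, r) \<notin> E) \<and>
     (\<forall>w\<in>V. w \<noteq> r \<longrightarrow> (\<exists>!v. (v, w) \<in> E))"

definition regular_digraph :: "'a set \<Rightarrow> ('a \<times> 'a) set \<Rightarrow> bool" where
  "regular_digraph V E \<longleftrightarrow> (\<forall>v\<in>V. \<forall>w\<in>V. out_nbrs E v \<approx> out_nbrs E w)"

end

theory Submission
  imports Defs
begin

(* Idea of the proof.
   Words in the letters A, B, C stand for the elements of G, acting on triples.  The Berggren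
   tree: every primitive Pythagorean triple (even second leg) is obtained from (3,4,5) by a unique
   word, found by descent along the common inverse of the generators.  As (3,4,5) = B(1,0,1), the
   matrix of a word w B sends (1,0,1) to the triple of w.
   (1) The condition 2 min(x,y) < z defining P is read off the word ("good" words), and the twelve
       forms defining H are exactly the words w B with w good; so evaluation at (1,0,1) is a
       bijection H' -> P and phi is its inverse.
   (2) The word set {[]} u {w B | w good} is a stable submonoid of the free monoid of words, hence
       free on its indecomposable elements; the atoms A^k B show it is infinitely generated.
   (3) Planar lattice geometry: a well-rounded sublattice of Z^2 has exactly the minimal vectors
       +-u, +-v, so theta is well defined; the lattice spanned by (q,0), (r,p) lies in C(p,q), so
       sin theta determines a nonempty class and psi is a bijection C2 -> P.
   (4) By construction of *, the bijection C2 -> H' -> words is a homomorphism, and a general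
       transport lemma carries the monoid properties of the word monoid to C2.
   (5) For any monoid with a free basis X, the Cayley digraph is a tree rooted at the unit whose
       out-neighbourhoods are all equipotent to X.
   The sections follow this order; the main theorem at the end only collects the results. *)

section \<open>Integer 3-vectors and 3x3 matrices in coordinates\<close>

text \<open>Coordinate bookkeeping: vec3 and unvec3 are mutually inverse, and matrices act by the
  usual row-times-column formula.\<close>
lemma vec3_eq_iff: "vec3 a = vec3 b \<longleftrightarrow> a = b"
  by (cases a; cases b) (auto simp: vec3_def vec_eq_iff forall_3)

lemma vec3_unvec3: "vec3 (unvec3 w) = w"
  by (simp add: vec_eq_iff forall_3 unvec3_def vec3_def)

lemma unvec3_vec3: "unvec3 (vec3 t) = t"
  by (cases t) (simp add: unvec3_def vec3_def)

lemma mat3_mulv: "mat3 (a1,a2,a3) (b1,b2,b3) (c1,c2,c3) *v vec3 (x,y,z) =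
   vec3 (a1*x+a2*y+a3*z, b1*x+b2*y+b3*z, c1*x+c2*y+c3*z)"
  by (simp add: vec_eq_iff forall_3 matrix_vector_mult_def sum_3 mat3_def vec3_def)

section \<open>Words in the Berggren generators\<close>

text \<open>Elements of the monoid G are represented by words in three letters; a word is read as
  the product of the corresponding matrices, and it acts on triples by the linear maps below.\<close>

datatype berggren = BA | BB | BC

fun gen_mat :: "berggren \<Rightarrow> int^3^3" where
  "gen_mat BA = MA" | "gen_mat BB = MB" | "gen_mat BC = MC"

fun gen_step :: "berggren \<Rightarrow> int \<times> int \<times> int \<Rightarrow> int \<times> int \<times> int" where
  "gen_step BA (x,y,z) = (x-2*y+2*z, 2*x-y+2*z, 2*x-2*y+3*z)"
| "gen_step BB (x,y,z) = (x+2*y+2*z, 2*x+y+2*z, 2*x+2*y+3*z)"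
| "gen_step BC (x,y,z) = (-x+2*y+2*z, -2*x+y+2*z, -2*x+2*y+3*z)"

fun word_mat :: "berggren list \<Rightarrow> int^3^3" where
  "word_mat [] = mat 1" | "word_mat (g # w) = gen_mat g ** word_mat w"

definition word_step :: "berggren list \<Rightarrow> int \<times> int \<times> int \<Rightarrow> int \<times> int \<times> int" where
  "word_step w t = foldr gen_step w t"

text \<open>Reading a word from the right: the last letter acts first.\<close>
lemma word_step_simps [simp]: "word_step [] t = t" "word_step (g # w) t = gen_step g (word_step w t)"
  by (simp_all add: word_step_def)

lemma word_step_append: "word_step (u @ v) t = word_step u (word_step v t)"
  by (simp add: word_step_def)

text \<open>Each generator matrix acts on column vectors as the corresponding linear map.\<close>
lemma gen_mat_mulv: "gen_mat g *v vec3 t = vec3 (gen_step g t)"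
  by (cases g; cases t) (simp_all add: MA_def MB_def MC_def mat3_mulv algebra_simps)

text \<open>The matrix of a word acts on column vectors as the word acts on triples.\<close>
lemma word_mat_mulv: "word_mat w *v vec3 t = vec3 (word_step w t)"
  by (induction w) (simp_all add: gen_mat_mulv matrix_vector_mul_assoc[symmetric])

text \<open>word_mat is a monoid homomorphism from words (concatenation) to matrices.\<close>
lemma word_mat_append: "word_mat (u @ v) = word_mat u ** word_mat v"
  by (induction u) (simp_all add: matrix_mul_assoc)

text \<open>G is exactly the set of matrices of words.\<close>
lemma Gmon_eq_words: "Gmon = range word_mat"
proof
  show "Gmon \<subseteq> range word_mat"
  proof
    fix M assume "M \<in> Gmon"
    then show "M \<in> range word_mat"
    proof induction
      case id show ?case by (metis rangeI word_mat.simps(1))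
    next
      case (mulA M) then obtain w where "M = word_mat w" by auto
      then have "M ** MA = word_mat (w @ [BA])" by (simp add: word_mat_append)
      then show ?case by auto
    next
      case (mulB M) then obtain w where "M = word_mat w" by auto
      then have "M ** MB = word_mat (w @ [BB])" by (simp add: word_mat_append)
      then show ?case by auto
    next
      case (mulC M) then obtain w where "M = word_mat w" by auto
      then have "M ** MC = word_mat (w @ [BC])" by (simp add: word_mat_append)
      then show ?case by auto
    qed
  qed
next
  have "word_mat w \<in> Gmon" for w
  proof (induction w rule: rev_induct)
    case Nil show ?case by (simp add: Gmon.id)
  next
    case (snoc g w) then show ?case
      by (cases g) (auto simp: word_mat_append intro: Gmon.intros)
  qed
  then show "range word_mat \<subseteq> Gmon" by blast
qed

section \<open>The Berggren tree of Pythagorean triples\<close>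

definition pyth :: "int \<times> int \<times> int \<Rightarrow> bool" where
  "pyth t \<longleftrightarrow> (case t of (x,y,z) \<Rightarrow> 0 < x \<and> 0 < y \<and> 0 < z \<and> x^2 + y^2 = z^2)"

text \<open>In a positive Pythagorean triple both legs are shorter than the hypotenuse.\<close>
lemma pyth_legs_lt: assumes "pyth (x,y,z)" shows "x < z" "y < z"
proof -
  from assms have h: "0 < x" "0 < y" "0 < z" "x^2 + y^2 = z^2" by (auto simp: pyth_def)
  moreover have "0 < x^2" "0 < y^2" using h by simp_all
  ultimately have "x^2 < z^2" "y^2 < z^2" by linarith+
  then show "x < z" "y < z" using h by (simp_all add: power_less_imp_less_base)
qed

text \<open>Each generator maps positive Pythagorean triples to positive Pythagorean triples.\<close>
lemma pyth_gen_step: assumes "pyth t" shows "pyth (gen_step g t)"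
proof -
  obtain x y z where t: "t = (x,y,z)" by (cases t)
  with assms have "0 < x" "0 < y" "0 < z" "x^2 + y^2 = z^2" by (auto simp: pyth_def)
  moreover have "x < z" "y < z" using pyth_legs_lt assms unfolding t by auto
  ultimately show ?thesis unfolding t
    by (cases g) (simp_all add: pyth_def power2_eq_square algebra_simps)
qed

text \<open>Hence so does every word.\<close>
lemma pyth_word_step: "pyth t \<Longrightarrow> pyth (word_step w t)"
  by (induction w) (simp_all add: pyth_gen_step)

text \<open>The common inverse of the three generators, up to the signs of the legs.\<close>
fun berggren_inv :: "int \<times> int \<times> int \<Rightarrow> int \<times> int \<times> int" where
  "berggren_inv (x,y,z) = (x + 2*y - 2*z, 2*x + y - 2*z, -2*x - 2*y + 3*z)"

text \<open>It undoes each generator, flipping the sign of one leg for A and for C.\<close>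
lemma berggren_inv_step:
  "berggren_inv (gen_step BA (x,y,z)) = (x, -y, z)"
  "berggren_inv (gen_step BB (x,y,z)) = (x, y, z)"
  "berggren_inv (gen_step BC (x,y,z)) = (-x, y, z)"
  by (simp_all add: algebra_simps)

text \<open>On positive triples the generator and the argument are determined by the image:
  the signs of the legs of the inverse image identify the generator.\<close>
lemma gen_step_inj: assumes "pyth t1" "pyth t2" "gen_step g1 t1 = gen_step g2 t2"
  shows "g1 = g2 \<and> t1 = t2"
proof -
  obtain x1 y1 z1 where t1: "t1 = (x1,y1,z1)" by (cases t1)
  obtain x2 y2 z2 where t2: "t2 = (x2,y2,z2)" by (cases t2)
  have "x1 > 0" "y1 > 0" "x2 > 0" "y2 > 0" using assms t1 t2 by (auto simp: pyth_def)
  moreover have "berggren_inv (gen_step g1 t1) = berggren_inv (gen_step g2 t2)" using assms by simp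
  ultimately show ?thesis unfolding t1 t2
    by (cases g1; cases g2) (simp_all only: berggren_inv_step, auto)
qed

text \<open>The root (3,4,5) of the Berggren tree.\<close>
definition berggren_root :: "int \<times> int \<times> int" where "berggren_root = (3,4,5)"

lemma pyth_root: "pyth berggren_root" by (simp add: pyth_def berggren_root_def)

text \<open>(3,4,5) has no parent: its inverse images have a vanishing leg.\<close>
lemma root_not_child: assumes "pyth t" shows "gen_step g t \<noteq> berggren_root"
proof
  assume e: "gen_step g t = berggren_root"
  obtain x y z where t: "t = (x,y,z)" by (cases t)
  have "y > 0" using assms t by (simp add: pyth_def)
  moreover have "berggren_inv (gen_step g t) = (1, 0, 1)" using e by (simp add: berggren_root_def)
  ultimately show False unfolding t by (cases g) (simp_all only: berggren_inv_step, auto)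
qed

text \<open>Distinct words send (3,4,5) to distinct triples.\<close>
lemma word_step_inj: "word_step w1 berggren_root = word_step w2 berggren_root \<Longrightarrow> w1 = w2"
proof (induction w1 arbitrary: w2)
  case Nil then show ?case
    using root_not_child[OF pyth_word_step[OF pyth_root]] by (cases w2) (auto simp del: gen_step.simps dest: sym)
next
  case (Cons g w1)
  show ?case
  proof (cases w2)
    case Nil then show ?thesis
      using Cons.prems root_not_child[OF pyth_word_step[OF pyth_root]] by (auto simp del: gen_step.simps)
  next
    case (Cons g' w)
    with Cons.prems have "g = g' \<and> word_step w1 berggren_root = word_step w berggren_root"
      using gen_step_inj[OF pyth_word_step[OF pyth_root] pyth_word_step[OF pyth_root]]
      by (simp del: gen_step.simps)
    then show ?thesis using Cons Cons.IH by simp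
  qed
qed

text \<open>Consequently distinct words have distinct matrices, so G is free on A, B, C.\<close>
lemma word_mat_inj: "inj word_mat"
proof
  fix w1 w2 assume "word_mat w1 = word_mat w2"
  then have "word_mat w1 *v vec3 berggren_root = word_mat w2 *v vec3 berggren_root" by simp
  then show "w1 = w2" by (simp add: word_mat_mulv vec3_eq_iff word_step_inj)
qed

section \<open>Primitive triples: every one lies in the tree\<close>

fun gcd3 :: "int \<times> int \<times> int \<Rightarrow> int" where "gcd3 (x,y,z) = gcd x (gcd y z)"

text \<open>The gcd of the three coordinates of a triple divides each coordinate.\<close>
lemma gcd3_dvd: "gcd3 (x,y,z) dvd x" "gcd3 (x,y,z) dvd y" "gcd3 (x,y,z) dvd z"
  by (auto intro: dvd_trans[OF gcd_dvd2])

text \<open>A common divisor of three integers divides every integral linear combination of them.\<close>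
lemma dvd_lin3: "(d::int) dvd x \<Longrightarrow> d dvd y \<Longrightarrow> d dvd z \<Longrightarrow> d dvd a*x + b*y + c*z"
  by (simp add: dvd_add dvd_mult)

text \<open>The generators are unimodular, so they preserve the gcd of the coordinates: both a triple
  and its image have the same common divisors.\<close>
lemma gcd3_gen_step: "gcd3 (gen_step g t) = gcd3 t"
proof -
  obtain x y z where t: "t = (x,y,z)" by (cases t)
  obtain x' y' z' where s: "gen_step g (x,y,z) = (x',y',z')" by (cases "gen_step g (x,y,z)")
  have fwd: "d dvd x' \<and> d dvd y' \<and> d dvd z'" if "d dvd x" "d dvd y" "d dvd z" for d
  proof -
    have "d dvd fst (gen_step g (x,y,z)) \<and> d dvd fst (snd (gen_step g (x,y,z)))
        \<and> d dvd snd (snd (gen_step g (x,y,z)))"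
      using that by (cases g) (auto intro!: dvd_add dvd_diff dvd_mult)
    then show ?thesis using s by simp
  qed
  have inv: "berggren_inv (x',y',z') \<in> {(x,y,z), (x,-y,z), (-x,y,z)}"
    unfolding s[symmetric] by (cases g) (simp_all only: berggren_inv_step, simp_all)
  have bwd: "d dvd x \<and> d dvd y \<and> d dvd z" if "d dvd x'" "d dvd y'" "d dvd z'" for d
  proof -
    have "d dvd 1*x' + 2*y' + (-2)*z'" "d dvd 2*x' + 1*y' + (-2)*z'" "d dvd (-2)*x' + (-2)*y' + 3*z'"
      by (rule dvd_lin3[OF that])+
    then show ?thesis using inv by auto
  qed
  have "gcd3 (x',y',z') dvd gcd3 (x,y,z)" "gcd3 (x,y,z) dvd gcd3 (x',y',z')"
    using fwd[OF gcd3_dvd] bwd[OF gcd3_dvd] by simp_all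
  then show ?thesis using s t by (simp add: zdvd_antisym_nonneg)
qed

text \<open>Primitive Pythagorean triples with even second leg (the set PPT).\<close>
definition ppt :: "int \<times> int \<times> int \<Rightarrow> bool" where
  "ppt t \<longleftrightarrow> pyth t \<and> even (fst (snd t)) \<and> gcd3 t = 1"

text \<open>ppt is the predicate form of the set PPT of the paper.\<close>
lemma ppt_iff_PPT: "ppt t \<longleftrightarrow> t \<in> PPT"
  by (cases t) (auto simp: ppt_def PPT_def pyth_def)

text \<open>The generators preserve primitive triples (parity of the second leg is preserved too).\<close>
lemma ppt_gen_step: assumes "ppt t" shows "ppt (gen_step g t)"
proof -
  obtain x y z where t: "t = (x,y,z)" by (cases t)
  have "even y" using assms t by (simp add: ppt_def)
  then have "even (fst (snd (gen_step g t)))" unfolding t by (cases g) auto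
  then show ?thesis using assms pyth_gen_step gcd3_gen_step unfolding ppt_def by simp
qed

text \<open>(3,4,5) is primitive, hence so is every triple of the tree.\<close>
lemma ppt_root: "ppt berggren_root"
  using pyth_root by (simp add: ppt_def berggren_root_def gcd_non_0_int)

lemma ppt_word_step: "ppt (word_step w berggren_root)"
  by (induction w) (simp_all add: ppt_root ppt_gen_step)

text \<open>In a primitive triple with even second leg the first leg is odd.\<close>
lemma ppt_odd_first: assumes "x^2 + y^2 = z^2" "even y" "gcd x (gcd y z) = (1::int)" shows "odd x"
proof
  assume "even x"
  then have "even (z^2)" using assms(1,2) by (metis even_add even_power zero_less_numeral)
  then have "2 dvd gcd x (gcd y z)" using \<open>even x\<close> assms(2) by simp
  then show False using assms(3) by simp
qed

text \<open>The hypotenuse of the inverse image is positive and strictly smaller.\<close>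
lemma parent_hyp_bounds: assumes "pyth (x,y,z)"
  shows "0 < -2*x - 2*y + 3*z" "-2*x - 2*y + 3*z < z"
proof -
  have h: "0 < x" "0 < y" "0 < z" "x^2 + y^2 = z^2" using assms by (auto simp: pyth_def)
  have "x*y*2 \<le> z^2" using h(4) sum_squares_ge_zero[of "x - y" 0]
    by (simp add: power2_eq_square algebra_simps)
  moreover have "(2*x+2*y)^2 = 4*z^2 + 4*(x*y*2)" using h(4) by (simp add: power2_eq_square algebra_simps)
  moreover have "(3*z)^2 = 9*z^2" "0 < z^2" using h(3) by simp_all
  ultimately have "(2*x+2*y)^2 < (3*z)^2" by linarith
  then have "2*x+2*y < 3*z" using h(3) power_less_imp_less_base[of "2*x+2*y" 2 "3*z"] by simp
  then show "0 < -2*x - 2*y + 3*z" by simp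
  have "(x+y)^2 = z^2 + 2*(x*y)" using h(4) by (simp add: power2_eq_square algebra_simps)
  then have "z^2 < (x+y)^2" using h(1,2) by simp
  then have "z < x + y" using h by (simp add: power_less_imp_less_base)
  then show "-2*x - 2*y + 3*z < z" by simp
qed

text \<open>The two legs of the inverse image cannot both be negative.\<close>
lemma parent_legs_not_both_neg: assumes "pyth (x,y,z)"
  shows "\<not> (x + 2*y - 2*z < 0 \<and> 2*x + y - 2*z < 0)"
proof
  assume "x + 2*y - 2*z < 0 \<and> 2*x + y - 2*z < 0"
  have h: "0 < x" "0 < y" "x^2 + y^2 = z^2" using assms by (auto simp: pyth_def)
  from \<open>x + 2*y - 2*z < 0 \<and> 2*x + y - 2*z < 0\<close> h
  have "(x+2*y)^2 < (2*z)^2" "(2*x+y)^2 < (2*z)^2"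
    using power_strict_mono[of "x+2*y" "2*z" 2] power_strict_mono[of "2*x+y" "2*z" 2] by simp_all
  then have "x*(4*y) < x*(3*x)" "y*(4*x) < y*(3*y)"
    using h(3) by (simp_all add: power2_eq_square algebra_simps)
  then have "4*y < 3*x" "4*x < 3*y" using h(1,2) by simp_all
  then show False using h(1,2) by linarith
qed

text \<open>A and C are B composed with a sign change of a leg, so an image under B of a triple with
  at most one negative leg is an image of the positive triple under A, B or C.\<close>
lemma gen_step_sign_normal: assumes "\<not> (a < 0 \<and> b < 0)"
  shows "\<exists>g. gen_step BB (a,b,c) = gen_step g (\<bar>a\<bar>, \<bar>b\<bar>, c)"
proof -
  consider "0 \<le> a" "0 \<le> b" | "0 \<le> a" "b < 0" | "a < 0" "0 \<le> b" using assms by linarith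
  then show ?thesis
  proof cases
    case 1 then show ?thesis by (intro exI[of _ BB]) simp
  next
    case 2 then show ?thesis by (intro exI[of _ BA]) simp
  next
    case 3 then show ?thesis by (intro exI[of _ BC]) simp
  qed
qed

text \<open>Descent: every primitive triple other than (3,4,5) is the image of a primitive triple
  with smaller hypotenuse under one of the generators, namely of the inverse image up to signs.\<close>
lemma ppt_parent: assumes "ppt (x,y,z)" "(x,y,z) \<noteq> berggren_root"
  shows "\<exists>g t. ppt t \<and> (x,y,z) = gen_step g t \<and> snd (snd t) < z"
proof -
  have p: "pyth (x,y,z)" and h: "x^2 + y^2 = z^2" "even y" "gcd x (gcd y z) = 1"
    using assms by (auto simp: ppt_def pyth_def)
  obtain a b c where abc: "berggren_inv (x,y,z) = (a,b,c)" by (cases "berggren_inv (x,y,z)")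
  then have abc_def: "a = x + 2*y - 2*z" "b = 2*x + y - 2*z" "c = -2*x - 2*y + 3*z" by auto
  have image: "(x,y,z) = gen_step BB (a,b,c)" unfolding abc_def by (simp add: algebra_simps)
  have c: "0 < c" "c < z" using parent_hyp_bounds[OF p] abc_def by simp_all
  have pyth_abc: "a^2 + b^2 = c^2" unfolding abc_def using h(1) by (simp add: power2_eq_square algebra_simps)
  have "odd a" unfolding abc_def using ppt_odd_first[OF h] by simp
  have "even b" unfolding abc_def using h(2) by simp
  have g: "gcd3 (a,b,c) = 1" using gcd3_gen_step[of BB "(a,b,c)"] image h(3) by simp
  have "b \<noteq> 0"
  proof
    assume "b = 0"
    then have "a = c \<or> a = -c" using pyth_abc by (simp add: power2_eq_iff)
    moreover have "a \<noteq> c" using g \<open>b = 0\<close> c(1) image assms(2) by (auto simp: berggren_root_def)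
    moreover have "a \<noteq> -c" using abc_def pyth_legs_lt[OF p] by linarith
    ultimately show False by blast
  qed
  have "ppt (\<bar>a\<bar>, \<bar>b\<bar>, c)"
    using pyth_abc g \<open>odd a\<close> \<open>b \<noteq> 0\<close> \<open>even b\<close> c(1) unfolding ppt_def pyth_def by auto
  moreover obtain g where "(x,y,z) = gen_step g (\<bar>a\<bar>, \<bar>b\<bar>, c)"
    using gen_step_sign_normal parent_legs_not_both_neg[OF p] image abc_def by metis
  ultimately show ?thesis using c(2) by auto
qed

text \<open>Hence every primitive triple is reached from (3,4,5) by a word.\<close>
lemma ppt_is_word: "ppt t \<Longrightarrow> \<exists>w. t = word_step w berggren_root"
proof (induction "nat (snd (snd t))" arbitrary: t rule: less_induct)
  case less
  obtain x y z where t: "t = (x,y,z)" by (cases t)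
  show ?case
  proof (cases "t = berggren_root")
    case True then show ?thesis by (metis word_step_simps(1))
  next
    case False
    then obtain g t' where parent: "ppt t'" "t = gen_step g t'" "snd (snd t') < z"
      using ppt_parent less.prems t by blast
    have "snd (snd t') > 0" using parent(1) by (cases t') (simp add: ppt_def pyth_def)
    then have "nat (snd (snd t')) < nat (snd (snd t))" using parent(3) unfolding t by simp
    then obtain w where "t' = word_step w berggren_root" using less.hyps parent(1) by blast
    then show ?thesis using parent(2) by (metis word_step_simps(2))
  qed
qed

section \<open>The condition 2 min(x,y) < z along the tree\<close>

text \<open>A leg can never be exactly half the hypotenuse, since 3 is not a rational square.\<close>
lemma sq_eq_three_sq: "(x::int)^2 = 3 * y^2 \<Longrightarrow> y = 0"
proof (induction "nat \<bar>y\<bar>" arbitrary: x y rule: less_induct)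
  case less
  show ?case
  proof (rule ccontr)
    assume "y \<noteq> 0"
    have "3 dvd x^2" using less.prems by simp
    then have "3 dvd x" using prime_dvd_power_int[of 3 x 2] by simp
    then obtain k where "x = 3*k" by blast
    then have k: "y^2 = 3 * k^2" using less.prems by (simp add: power2_eq_square)
    then have "k \<noteq> 0" using \<open>y \<noteq> 0\<close> by auto
    then have "k^2 < y^2" using k by simp
    then have "nat \<bar>k\<bar> < nat \<bar>y\<bar>" using abs_le_square_iff[of y k] by (simp add: not_le[symmetric])
    then have "k = 0" using less.hyps k by blast
    then show False using \<open>k \<noteq> 0\<close> by simp
  qed
qed

lemma pyth_leg_ne_half: assumes "pyth (x,y,z)" shows "2*x \<noteq> z" "2*y \<noteq> z"
proof -
  have h: "0 < x" "0 < y" "x^2 + y^2 = z^2" using assms by (auto simp: pyth_def)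
  show "2*x \<noteq> z"
  proof
    assume "2*x = z"
    then have "x^2 + y^2 = (2*x)^2" using h(3) by simp
    then have "y^2 = 3*x^2" by (simp add: power2_eq_square algebra_simps)
    then show False using sq_eq_three_sq h(1) by auto
  qed
  show "2*y \<noteq> z"
  proof
    assume "2*y = z"
    then have "x^2 + y^2 = (2*y)^2" using h(3) by simp
    then have "x^2 = 3*y^2" by (simp add: power2_eq_square algebra_simps)
    then show False using sq_eq_three_sq h(2) by auto
  qed
qed

text \<open>The two halves of the condition 2 min(x,y) < z.\<close>
fun small_x :: "int \<times> int \<times> int \<Rightarrow> bool" where "small_x (x,y,z) \<longleftrightarrow> 2*x < z"
fun small_y :: "int \<times> int \<times> int \<Rightarrow> bool" where "small_y (x,y,z) \<longleftrightarrow> 2*y < z"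

text \<open>How the generators change the two conditions: only A can produce a small first leg
  (exactly when the second leg was not small) and only C a small second leg.\<close>
lemma small_gen_step: assumes "pyth t"
  shows "small_x (gen_step BA t) = (\<not> small_y t)" "\<not> small_y (gen_step BA t)"
        "\<not> small_x (gen_step BB t)" "\<not> small_y (gen_step BB t)"
        "\<not> small_x (gen_step BC t)" "small_y (gen_step BC t) = (\<not> small_x t)"
proof -
  obtain x y z where t: "t = (x,y,z)" by (cases t)
  have "0 < x" "0 < y" "0 < z" using assms t by (auto simp: pyth_def)
  moreover have "2*x \<noteq> z" "2*y \<noteq> z" using pyth_leg_ne_half assms t by auto
  ultimately show "small_x (gen_step BA t) = (\<not> small_y t)" "\<not> small_y (gen_step BA t)"
        "\<not> small_x (gen_step BB t)" "\<not> small_y (gen_step BB t)"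
        "\<not> small_x (gen_step BC t)" "small_y (gen_step BC t) = (\<not> small_x t)"
    unfolding t by auto
qed

text \<open>The same conditions read off the word: a word yields a small first leg iff it starts
  with A followed by a word not yielding a small second leg, and symmetrically.\<close>
fun small_x_word :: "berggren list \<Rightarrow> bool" and small_y_word :: "berggren list \<Rightarrow> bool" where
  "small_x_word [] = False"
| "small_x_word (g # w) = (g = BA \<and> \<not> small_y_word w)"
| "small_y_word [] = False"
| "small_y_word (g # w) = (g = BC \<and> \<not> small_x_word w)"

lemma small_word_step:
  "small_x (word_step w berggren_root) = small_x_word w \<and> small_y (word_step w berggren_root) = small_y_word w"
proof (induction w)
  case Nil show ?case by (simp add: berggren_root_def)
next
  case (Cons g w)
  show ?case using small_gen_step[OF pyth_word_step[OF pyth_root]] Cons by (cases g) auto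
qed

text \<open>A word is good if its triple satisfies one of the two conditions.\<close>
definition good_word :: "berggren list \<Rightarrow> bool" where
  "good_word w \<longleftrightarrow> small_x_word w \<or> small_y_word w"

text \<open>The condition defining P, along the tree: 2 min(x,y) < z holds exactly for good words.\<close>
lemma twice_min_lt_iff_good:
  "(case word_step w berggren_root of (x,y,z) \<Rightarrow> 2 * min x y < z) \<longleftrightarrow> good_word w"
  using small_word_step[of w] by (cases "word_step w berggren_root") (auto simp: good_word_def min_def)

section \<open>H' as a set of words\<close>

text \<open>The alternating words (AC)^k and (CA)^k.\<close>
definition alt_AC :: "nat \<Rightarrow> berggren list" where "alt_AC k = concat (replicate k [BA, BC])"
definition alt_CA :: "nat \<Rightarrow> berggren list" where "alt_CA k = concat (replicate k [BC, BA])"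

lemma alt_AC_simps [simp]: "alt_AC 0 = []" "alt_AC (Suc k) = BA # BC # alt_AC k"
  by (simp_all add: alt_AC_def)
lemma alt_CA_simps [simp]: "alt_CA 0 = []" "alt_CA (Suc k) = BC # BA # alt_CA k"
  by (simp_all add: alt_CA_def)

text \<open>An alternating prefix does not change the conditions.\<close>
lemma small_x_word_alt: "small_x_word (alt_AC k @ w) = small_x_word w"
  by (induction k) simp_all
lemma small_y_word_alt: "small_y_word (alt_CA k @ w) = small_y_word w"
  by (induction k) simp_all

text \<open>Normal forms of the words yielding a small first leg: (AC)^k A, (AC)^k A A n, (AC)^k A B n.\<close>
lemma small_x_word_iff:
  "small_x_word w \<longleftrightarrow> (\<exists>k n. w = alt_AC k @ [BA] \<or> w = alt_AC k @ BA # BA # n \<or> w = alt_AC k @ BA # BB # n)"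
proof
  show "small_x_word w \<Longrightarrow> \<exists>k n. w = alt_AC k @ [BA] \<or> w = alt_AC k @ BA # BA # n \<or> w = alt_AC k @ BA # BB # n"
  proof (induction "length w" arbitrary: w rule: less_induct)
    case less
    then obtain w' where w: "w = BA # w'" "\<not> small_y_word w'" by (cases w) auto
    show ?case
    proof (cases w')
      case Nil then show ?thesis using w by (metis alt_AC_simps(1) append_Nil)
    next
      case (Cons g w'')
      show ?thesis
      proof (cases g)
        case BC
        then have "small_x_word w''" "length w'' < length w" using w Cons by auto
        then obtain k n where "w'' = alt_AC k @ [BA] \<or> w'' = alt_AC k @ BA # BA # n \<or> w'' = alt_AC k @ BA # BB # n"
          using less.hyps by blast
        then have "w = alt_AC (Suc k) @ [BA] \<or> w = alt_AC (Suc k) @ BA # BA # n \<or> w = alt_AC (Suc k) @ BA # BB # n"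
          using w Cons BC by auto
        then show ?thesis by blast
      qed (use w Cons in \<open>metis alt_AC_simps(1) append_Nil\<close>)+
    qed
  qed
qed (auto simp: small_x_word_alt)

lemma small_y_word_iff:
  "small_y_word w \<longleftrightarrow> (\<exists>k n. w = alt_CA k @ [BC] \<or> w = alt_CA k @ BC # BC # n \<or> w = alt_CA k @ BC # BB # n)"
proof
  show "small_y_word w \<Longrightarrow> \<exists>k n. w = alt_CA k @ [BC] \<or> w = alt_CA k @ BC # BC # n \<or> w = alt_CA k @ BC # BB # n"
  proof (induction "length w" arbitrary: w rule: less_induct)
    case less
    then obtain w' where w: "w = BC # w'" "\<not> small_x_word w'" by (cases w) auto
    show ?case
    proof (cases w')
      case Nil then show ?thesis using w by (metis alt_CA_simps(1) append_Nil)
    next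
      case (Cons g w'')
      show ?thesis
      proof (cases g)
        case BA
        then have "small_y_word w''" "length w'' < length w" using w Cons by auto
        then obtain k n where "w'' = alt_CA k @ [BC] \<or> w'' = alt_CA k @ BC # BC # n \<or> w'' = alt_CA k @ BC # BB # n"
          using less.hyps by blast
        then have "w = alt_CA (Suc k) @ [BC] \<or> w = alt_CA (Suc k) @ BC # BC # n \<or> w = alt_CA (Suc k) @ BC # BB # n"
          using w Cons BA by auto
        then show ?thesis by blast
      qed (use w Cons in \<open>metis alt_CA_simps(1) append_Nil\<close>)+
    qed
  qed
qed (auto simp: small_y_word_alt)

text \<open>Matrix powers and the generators as matrices of words.\<close>
lemma mpow_word_mat: "mpow (word_mat u) k = word_mat (concat (replicate k u))"
  by (induction k) (simp_all add: word_mat_append)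

lemma gens_as_words: "MA = word_mat [BA]" "MB = word_mat [BB]" "MC = word_mat [BC]"
  by simp_all

text \<open>The twelve forms of matrices in H, written as words.\<close>
definition H_words :: "berggren list set" where
  "H_words = {w. \<exists>n k. 0 < k \<and>
     (w = BA # BA # n @ [BB] \<or> w = replicate k BA @ [BB] \<or> w = BA # BB # n @ [BB] \<or>
      w = BC # BC # n @ [BB] \<or> w = replicate k BC @ [BB] \<or> w = BC # BB # n @ [BB] \<or>
      w = alt_AC k @ BA # BA # n @ [BB] \<or> w = alt_AC k @ BA # BB # n @ [BB] \<or> w = alt_AC k @ [BA, BB] \<or>
      w = alt_CA k @ BC # BC # n @ [BB] \<or> w = alt_CA k @ BC # BB # n @ [BB] \<or> w = alt_CA k @ [BC, BB])}"

text \<open>Rewriting each product of generators in the definition of H as the matrix of a word.\<close>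
lemma Hset_eq_words: "Hset = word_mat ` H_words"
proof -
  have "Hset = {M. \<exists>n k. 0 < k \<and>
     (M = word_mat (BA # BA # n @ [BB]) \<or> M = word_mat (replicate k BA @ [BB]) \<or> M = word_mat (BA # BB # n @ [BB]) \<or>
      M = word_mat (BC # BC # n @ [BB]) \<or> M = word_mat (replicate k BC @ [BB]) \<or> M = word_mat (BC # BB # n @ [BB]) \<or>
      M = word_mat (alt_AC k @ BA # BA # n @ [BB]) \<or> M = word_mat (alt_AC k @ BA # BB # n @ [BB]) \<or>
      M = word_mat (alt_AC k @ [BA, BB]) \<or>
      M = word_mat (alt_CA k @ BC # BC # n @ [BB]) \<or> M = word_mat (alt_CA k @ BC # BB # n @ [BB]) \<or>
      M = word_mat (alt_CA k @ [BC, BB]))}"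
    unfolding Hset_def Gmon_eq_words
    by (simp only: gens_as_words mpow_word_mat word_mat_append[symmetric] append_Cons append_Nil
        append_assoc alt_AC_def[symmetric] alt_CA_def[symmetric] concat_replicate_single bex_simps bex_UNIV)
  then show ?thesis unfolding H_words_def by blast
qed

text \<open>Membership in a set of words with a prescribed last letter.\<close>
lemma mem_snoc_set: "x \<in> {v @ [a] | v. P v} \<longleftrightarrow> x \<noteq> [] \<and> last x = a \<and> P (butlast x)"
proof (cases x rule: rev_cases)
  case (snoc ys y) then show ?thesis by auto
qed simp

text \<open>The words A^k and C^k, k > 0, are good.\<close>
lemma good_replicate: assumes "0 < k" shows "good_word (replicate k BA)" "good_word (replicate k BC)"
proof -
  obtain j where k: "k = Suc j" using assms by (cases k) auto
  show "good_word (replicate k BA)" "good_word (replicate k BC)"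
    unfolding k good_word_def by (cases j; simp)+
qed

text \<open>Every word of H_words is a good word followed by B ...\<close>
lemma H_words_good: assumes "x \<in> H_words" shows "x \<noteq> [] \<and> last x = BB \<and> good_word (butlast x)"
proof -
  obtain n k where k: "0 < k" and x: "x = BA # BA # n @ [BB] \<or> x = replicate k BA @ [BB] \<or>
      x = BA # BB # n @ [BB] \<or> x = BC # BC # n @ [BB] \<or> x = replicate k BC @ [BB] \<or>
      x = BC # BB # n @ [BB] \<or> x = alt_AC k @ BA # BA # n @ [BB] \<or> x = alt_AC k @ BA # BB # n @ [BB] \<or>
      x = alt_AC k @ [BA, BB] \<or> x = alt_CA k @ BC # BC # n @ [BB] \<or> x = alt_CA k @ BC # BB # n @ [BB] \<or>
      x = alt_CA k @ [BC, BB]"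
    using assms unfolding H_words_def by blast
  then show ?thesis using good_replicate[OF k]
    by (elim disjE) (simp_all add: butlast_append good_word_def small_x_word_alt small_y_word_alt)
qed

text \<open>... and conversely, by the normal forms of good words (the case k = 0 of the alternating
  prefix gives the forms without prefix).\<close>
lemma small_x_word_in_H_words: assumes "small_x_word w" shows "w @ [BB] \<in> H_words"
proof -
  obtain k n where w: "w = alt_AC k @ [BA] \<or> w = alt_AC k @ BA # BA # n \<or> w = alt_AC k @ BA # BB # n"
    using small_x_word_iff[THEN iffD1, OF assms] by blast
  show ?thesis
  proof (cases "k = 0")
    case True then show ?thesis using w unfolding H_words_def
      by (elim disjE; intro CollectI exI[of _ n] exI[of _ "1::nat"]; simp)
  next
    case False then show ?thesis using w unfolding H_words_def
      by (elim disjE; intro CollectI exI[of _ n] exI[of _ k]; simp)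
  qed
qed

text \<open>The symmetric statement for a small second leg.\<close>
lemma small_y_word_in_H_words: assumes "small_y_word w" shows "w @ [BB] \<in> H_words"
proof -
  obtain k n where w: "w = alt_CA k @ [BC] \<or> w = alt_CA k @ BC # BC # n \<or> w = alt_CA k @ BC # BB # n"
    using small_y_word_iff[THEN iffD1, OF assms] by blast
  show ?thesis
  proof (cases "k = 0")
    case True then show ?thesis using w unfolding H_words_def
      by (elim disjE; intro CollectI exI[of _ n] exI[of _ "1::nat"]; simp)
  next
    case False then show ?thesis using w unfolding H_words_def
      by (elim disjE; intro CollectI exI[of _ n] exI[of _ k]; simp)
  qed
qed

text \<open>Hence H_words consists exactly of the good words followed by B.\<close>
lemma H_words_eq: "H_words = {w @ [BB] | w. good_word w}"
proof
  show "H_words \<subseteq> {w @ [BB] | w. good_word w}"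
  proof
    fix x assume "x \<in> H_words"
    then show "x \<in> {w @ [BB] | w. good_word w}" unfolding mem_snoc_set by (rule H_words_good)
  qed
  show "{w @ [BB] | w. good_word w} \<subseteq> H_words"
    using small_x_word_in_H_words small_y_word_in_H_words unfolding good_word_def by blast
qed

text \<open>The word monoid corresponding to H': the empty word and the words w B with w good.\<close>
definition word_monoid :: "berggren list set" where
  "word_monoid = insert [] {w @ [BB] | w. good_word w}"

text \<open>H' is the image of the word monoid under word_mat.\<close>
lemma H'_eq_word_monoid: "H' = word_mat ` word_monoid"
  unfolding H'_def word_monoid_def Hset_eq_words H_words_eq by simp

section \<open>Stable submonoids of free monoids are free\<close>

text \<open>A set of words containing the empty word and closed under concatenation is stable if
  u, uv, vw, w in W imply v in W.  Such a submonoid of the free monoid is itself free, with its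
  indecomposable nonempty elements (atoms) as basis.\<close>
locale stable_word_monoid =
  fixes W :: "'a list set"
  assumes Nil_mem: "[] \<in> W"
    and append_mem: "u \<in> W \<Longrightarrow> v \<in> W \<Longrightarrow> u @ v \<in> W"
    and stable: "u \<in> W \<Longrightarrow> u @ v \<in> W \<Longrightarrow> v @ w \<in> W \<Longrightarrow> w \<in> W \<Longrightarrow> v \<in> W"
begin

definition atoms :: "'a list set" where
  "atoms = {h \<in> W. h \<noteq> [] \<and> \<not> (\<exists>a b. a \<in> W \<and> b \<in> W \<and> a \<noteq> [] \<and> b \<noteq> [] \<and> h = a @ b)}"

text \<open>Basic closure properties of W.\<close>
lemma atoms_mem: "atoms \<subseteq> W" unfolding atoms_def by auto

lemma concat_mem: "set xs \<subseteq> W \<Longrightarrow> concat xs \<in> W"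
  by (induction xs) (simp_all add: Nil_mem append_mem)

text \<open>In the free monoid, the product of a word of words is its concatenation.\<close>
lemma word_prod_concat: "word_prod (@) [] xs = concat xs"
  unfolding word_prod_def by (induction xs) auto

lemma is_monoid: "is_monoid W (@) []"
  unfolding is_monoid_def using append_mem Nil_mem by auto

text \<open>Every element is a concatenation of atoms (induction on length).\<close>
lemma atoms_factor: "m \<in> W \<Longrightarrow> \<exists>xs. set xs \<subseteq> atoms \<and> concat xs = m"
proof (induction "length m" arbitrary: m rule: less_induct)
  case less
  show ?case
  proof (cases "m = [] \<or> m \<in> atoms")
    case True
    then show ?thesis
    proof
      assume "m = []" then show ?thesis by (intro exI[of _ "[]"]) simp
    next
      assume "m \<in> atoms" then show ?thesis by (intro exI[of _ "[m]"]) simp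
    qed
  next
    case False
    then obtain a b where ab: "a \<in> W" "b \<in> W" "a \<noteq> []" "b \<noteq> []" "m = a @ b"
      using less.prems unfolding atoms_def by blast
    then have "length a < length m" "length b < length m" by auto
    then obtain xs ys where "set xs \<subseteq> atoms" "concat xs = a" "set ys \<subseteq> atoms" "concat ys = b"
      using less.hyps ab by meson
    then show ?thesis using ab by (intro exI[of _ "xs @ ys"]) auto
  qed
qed

text \<open>Stability forces two factorisations into atoms to start with the same atom.\<close>
lemma atoms_prefix_eq:
  assumes x: "x \<in> atoms" and y: "y \<in> atoms" and xs: "set xs \<subseteq> atoms" and ys: "set ys \<subseteq> atoms"
    and eq: "x @ concat xs = y @ concat ys" and len: "length x \<le> length y"
  shows "x = y"
proof (rule ccontr)
  assume "x \<noteq> y"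
  obtain v where v: "y = x @ v" "concat xs = v @ concat ys"
    using eq len by (metis append_eq_append_conv_if append_eq_conv_conj)
  have "concat xs \<in> W" "concat ys \<in> W" using xs ys atoms_mem concat_mem by auto
  then have "v \<in> W" using stable[of x v "concat ys"] x y atoms_mem v by auto
  moreover have "v \<noteq> []" using v \<open>x \<noteq> y\<close> by auto
  ultimately show False using x y v unfolding atoms_def by blast
qed

lemma atoms_unique: "set xs \<subseteq> atoms \<Longrightarrow> set ys \<subseteq> atoms \<Longrightarrow> concat xs = concat ys \<Longrightarrow> xs = ys"
proof (induction xs arbitrary: ys)
  case Nil then show ?case using atoms_def by (cases ys) auto
next
  case (Cons x xs)
  then obtain y ys' where ys: "ys = y # ys'" using atoms_def by (cases ys) auto
  have "x \<in> atoms" "y \<in> atoms" "set xs \<subseteq> atoms" "set ys' \<subseteq> atoms"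
    and eq: "x @ concat xs = y @ concat ys'" using Cons.prems ys by auto
  then have "x = y" using atoms_prefix_eq[of x y xs ys'] atoms_prefix_eq[of y x ys' xs] by force
  then show ?case using Cons.IH Cons.prems ys eq by auto
qed

lemma free_basis_atoms: "free_basis W (@) [] atoms"
  unfolding free_basis_def word_prod_concat using atoms_mem atoms_factor atoms_unique by blast

text \<open>Any generating set contains every atom: a factorisation of an atom into nonempty
  generators has a single factor.\<close>
lemma generators_contain_atoms: assumes "generates W (@) [] F" shows "atoms \<subseteq> F"
proof
  fix a assume a: "a \<in> atoms"
  obtain xs where xs: "set xs \<subseteq> F" "concat xs = a"
    using assms a atoms_mem unfolding generates_def word_prod_concat by blast
  have F: "F \<subseteq> W" using assms unfolding generates_def by auto
  let ?ys = "filter (\<lambda>x. x \<noteq> []) xs"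
  have c: "concat ?ys = a" using xs(2) by (induction xs arbitrary: a) auto
  have sy: "set ?ys \<subseteq> W - {[]}" using xs(1) F by auto
  have "a \<noteq> []" using a atoms_def by auto
  then obtain y ys where yy: "?ys = y # ys" using c by (cases ?ys) auto
  have "ys = []"
  proof (rule ccontr)
    assume "ys \<noteq> []"
    then have "concat ys \<noteq> []" using sy yy by (cases ys) auto
    moreover have "concat ys \<in> W" using sy yy concat_mem by auto
    moreover have "y \<in> W" "y \<noteq> []" using sy yy by auto
    moreover have "a = y @ concat ys" using c yy by simp
    ultimately show False using a unfolding atoms_def by blast
  qed
  moreover have "y \<in> set xs" using yy by (metis filter_is_subset list.set_intros(1) subsetD)
  ultimately show "a \<in> F" using c yy xs(1) by auto
qed

lemma infinitely_generated: "infinite atoms \<Longrightarrow> infinitely_generated W (@) []"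
  unfolding infinitely_generated_def using generators_contain_atoms finite_subset by blast

end

section \<open>The word monoid of H' is free, infinitely generated and not commutative\<close>

text \<open>Concatenation keeps goodness of the first part, since B stops the alternation.\<close>
lemma small_words_append_B:
  "small_x_word (x @ BB # y) = small_x_word x \<and> small_y_word (x @ BB # y) = small_y_word x"
  by (induction x) auto

lemma good_word_append_B: "good_word (x @ BB # y) = good_word x"
  using small_words_append_B by (simp add: good_word_def)

text \<open>The two kinds of elements of the word monoid.\<close>
lemma word_monoid_cases:
  assumes "x \<in> word_monoid" obtains "x = []" | w where "x = w @ [BB]" "good_word w"
  using assms unfolding word_monoid_def by blast

lemma word_monoid_snoc: "good_word w \<Longrightarrow> w @ [BB] \<in> word_monoid"
  unfolding word_monoid_def by blast

text \<open>The word monoid of H' is stable: if v w and u v are in it with u, w nonempty, then v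
  ends in B, and its part before that B is good because v w is.\<close>
interpretation words: stable_word_monoid word_monoid
proof
  show "[] \<in> word_monoid" by (simp add: word_monoid_def)
next
  fix u v assume u: "u \<in> word_monoid" and v: "v \<in> word_monoid"
  show "u @ v \<in> word_monoid"
  proof (cases "u = [] \<or> v = []")
    case True then show ?thesis using u v by auto
  next
    case False
    then obtain x y where "u = x @ [BB]" "v = y @ [BB]" "good_word x"
      using u v by (metis word_monoid_cases)
    then have "u @ v = (x @ BB # y) @ [BB]" "good_word (x @ BB # y)" by (simp_all add: good_word_append_B)
    then show ?thesis using word_monoid_snoc by metis
  qed
next
  fix u v w assume u: "u \<in> word_monoid" and uv: "u @ v \<in> word_monoid"
    and vw: "v @ w \<in> word_monoid" and w: "w \<in> word_monoid"
  show "v \<in> word_monoid"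
  proof (cases "v = [] \<or> u = [] \<or> w = []")
    case True then show ?thesis using uv vw by (auto simp: word_monoid_def)
  next
    case False
    obtain g where "u @ v = g @ [BB]" using uv False by (metis word_monoid_cases Nil_is_append_conv)
    then have "last v = BB" using False by (metis last_appendR last_snoc)
    then obtain v' where v: "v = v' @ [BB]" using False by (metis append_butlast_last_id)
    obtain w' where w': "w = w' @ [BB]" using w False by (metis word_monoid_cases)
    obtain h where "v @ w = h @ [BB]" "good_word h" using vw False by (metis word_monoid_cases Nil_is_append_conv)
    then have "good_word (v' @ BB # w')" using v w' by simp
    then show ?thesis using v good_word_append_B word_monoid_snoc by metis
  qed
qed

text \<open>The words A^k B are atoms, so there are infinitely many of them.\<close>
lemma replicate_A_atom: "replicate (Suc k) BA @ [BB] \<in> words.atoms"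
proof -
  have mem: "replicate (Suc k) BA @ [BB] \<in> word_monoid"
    unfolding word_monoid_def using good_replicate(1)[of "Suc k"] by blast
  have "False" if ab: "a \<in> word_monoid" "b \<in> word_monoid" "a \<noteq> []" "b \<noteq> []"
    "replicate (Suc k) BA @ [BB] = a @ b" for a b
  proof -
    have "replicate (Suc k) BA = a @ butlast b"
      using arg_cong[OF ab(5), of butlast] ab(4) by (simp add: butlast_append)
    then have "set a \<subseteq> {BA}" by (metis set_append Un_upper1 set_replicate Zero_not_Suc)
    moreover have "BB \<in> set a" using ab(1,3) by (metis word_monoid_cases in_set_conv_decomp)
    ultimately show False by auto
  qed
  then show ?thesis using mem unfolding words.atoms_def by blast
qed

lemma infinite_atoms: "infinite words.atoms"
proof -
  have "inj (\<lambda>k. replicate (Suc k) BA @ [BB])" by (rule injI) simp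
  then have "infinite (range (\<lambda>k. replicate (Suc k) BA @ [BB]))" by (simp add: range_inj_infinite)
  then show ?thesis using replicate_A_atom finite_subset by (metis image_subsetI)
qed

text \<open>A B and C B do not commute.\<close>
lemma word_monoid_noncomm: "\<exists>a\<in>word_monoid. \<exists>b\<in>word_monoid. a @ b \<noteq> b @ a"
proof -
  have "[BA, BB] \<in> word_monoid" "[BC, BB] \<in> word_monoid" unfolding word_monoid_def good_word_def
    by (auto intro!: exI[of _ "[BA]"] exI[of _ "[BC]"])
  moreover have "[BA, BB] @ [BC, BB] \<noteq> [BC, BB] @ [BA, BB]" by simp
  ultimately show ?thesis by blast
qed

section \<open>The bijection phi between P and H'\<close>

text \<open>Since B sends (1,0,1) to (3,4,5), a word w B sends (1,0,1) to the triple of w.\<close>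
lemma word_step_snoc_B: "word_step (w @ [BB]) (1,0,1) = word_step w berggren_root"
  by (simp add: word_step_append berggren_root_def)

text \<open>Evaluating elements of the word monoid at (1,0,1) lands in P ...\<close>
lemma word_monoid_to_PP: assumes "u \<in> word_monoid" shows "word_step u (1,0,1) \<in> PP"
  using assms
proof (cases rule: word_monoid_cases)
  case 1 then show ?thesis by (simp add: PP_def)
next
  case (2 w)
  have "word_step w berggren_root \<in> PPT" using ppt_word_step ppt_iff_PPT by blast
  moreover have "case word_step w berggren_root of (x,y,z) \<Rightarrow> 2 * min x y < z"
    using twice_min_lt_iff_good[THEN iffD2, OF 2(2)] .
  ultimately show ?thesis unfolding PP_def 2 word_step_snoc_B by (auto split: prod.splits)
qed

text \<open>... and every element of P is obtained this way.\<close>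
lemma PP_to_word_monoid: assumes "t \<in> PP" shows "\<exists>u\<in>word_monoid. word_step u (1,0,1) = t"
proof (cases "t = (1,0,1)")
  case True then show ?thesis using words.Nil_mem by force
next
  case False
  then have "t \<in> PPT" "case t of (x,y,z) \<Rightarrow> 2 * min x y < z" using assms unfolding PP_def by auto
  moreover obtain w where w: "t = word_step w berggren_root" using calculation(1) ppt_is_word ppt_iff_PPT by blast
  ultimately have "good_word w" using twice_min_lt_iff_good by simp
  then show ?thesis using w word_step_snoc_B word_monoid_snoc by metis
qed

text \<open>Different elements of the word monoid give different triples.\<close>
lemma word_step_inj_on_word_monoid:
  assumes "u1 \<in> word_monoid" "u2 \<in> word_monoid" "word_step u1 (1,0,1) = word_step u2 (1,0,1)"
  shows "u1 = u2"
proof -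
  have not_base: "word_step w berggren_root \<noteq> (1,0,1)" for w
    using pyth_word_step[OF pyth_root, of w] by (auto simp: pyth_def)
  show ?thesis
  proof (cases "u1 = [] \<or> u2 = []")
    case True then show ?thesis using assms not_base word_step_snoc_B
      by (metis word_monoid_cases word_step_simps(1))
  next
    case False
    then obtain w1 w2 where "u1 = w1 @ [BB]" "u2 = w2 @ [BB]" using assms(1,2) by (metis word_monoid_cases)
    then show ?thesis using assms(3) word_step_snoc_B word_step_inj by metis
  qed
qed

text \<open>For t in P there is exactly one M in H' with M (1,0,1)^t = t^t.\<close>
lemma H'_unique_matrix: assumes t: "t \<in> PP" shows "\<exists>!M. M \<in> H' \<and> M *v vec3 (1, 0, 1) = vec3 t"
proof -
  obtain u where u: "u \<in> word_monoid" "word_step u (1,0,1) = t" using PP_to_word_monoid t by blast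
  show ?thesis
  proof (rule ex1I[of _ "word_mat u"])
    show "word_mat u \<in> H' \<and> word_mat u *v vec3 (1, 0, 1) = vec3 t"
      using u H'_eq_word_monoid word_mat_mulv by auto
  next
    fix M assume M: "M \<in> H' \<and> M *v vec3 (1, 0, 1) = vec3 t"
    then obtain u' where u': "u' \<in> word_monoid" "M = word_mat u'" using H'_eq_word_monoid by auto
    then have "word_step u' (1,0,1) = t" using M word_mat_mulv vec3_eq_iff by metis
    then have "u' = u" using word_step_inj_on_word_monoid u u' by simp
    then show "M = word_mat u" using u' by simp
  qed
qed

text \<open>Evaluation at (1,0,1) maps H' into P.\<close>
lemma H'_image_in_PP: "M \<in> H' \<Longrightarrow> unvec3 (M *v vec3 (1,0,1)) \<in> PP"
  unfolding H'_eq_word_monoid using word_monoid_to_PP by (auto simp: word_mat_mulv unvec3_vec3)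

text \<open>phi t is the matrix of H' sending (1,0,1) to t.\<close>
lemma phi_PP: "t \<in> PP \<Longrightarrow> phi t \<in> H' \<and> phi t *v vec3 (1, 0, 1) = vec3 t"
  unfolding phi_def using H'_unique_matrix by (rule theI')

text \<open>phi inverts evaluation at (1,0,1) on H'.\<close>
lemma phi_eval: assumes M: "M \<in> H'" shows "phi (unvec3 (M *v vec3 (1,0,1))) = M"
proof -
  let ?t = "unvec3 (M *v vec3 (1,0,1))"
  have t: "?t \<in> PP" using H'_image_in_PP M by blast
  have "M \<in> H' \<and> M *v vec3 (1, 0, 1) = vec3 ?t" using M by (simp add: vec3_unvec3)
  then show ?thesis using phi_PP[OF t] H'_unique_matrix[OF t] by blast
qed

lemma phi_bij: "bij_betw phi PP H'"
proof (rule bij_betw_imageI)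
  show "inj_on phi PP" by (rule inj_onI) (metis phi_PP vec3_eq_iff)
  show "phi ` PP = H'" using phi_PP phi_eval H'_image_in_PP by (metis image_eqI image_subsetI subsetI subset_antisym)
qed

text \<open>H' is closed under multiplication and contains the identity.\<close>
lemma H'_mult_closed: "M1 \<in> H' \<Longrightarrow> M2 \<in> H' \<Longrightarrow> M1 ** M2 \<in> H'"
  unfolding H'_eq_word_monoid using words.append_mem by (auto simp flip: word_mat_append)

lemma mat1_H': "mat 1 \<in> H'" unfolding H'_def by simp

section \<open>Planar vectors\<close>

text \<open>Squared norm and determinant of planar vectors.\<close>
definition nsq :: "real \<times> real \<Rightarrow> real" where "nsq x = fst x ^ 2 + snd x ^ 2"
definition det2 :: "real \<times> real \<Rightarrow> real \<times> real \<Rightarrow> real" where "det2 x y = fst x * snd y - snd x * fst y"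

lemma norm_sq_nsq: "(norm x)^2 = nsq x"
  by (cases x) (simp add: norm_Pair nsq_def)

lemma norm_eq_sqrt_nsq: "norm x = sqrt (nsq x)"
  using norm_sq_nsq by (metis norm_ge_zero real_sqrt_unique)

lemma inner_pair: "inner x y = fst x * fst y + snd x * snd y"
  by (cases x; cases y) simp

lemma nsq_eq_0: "nsq x = 0 \<longleftrightarrow> x = 0"
  by (cases x) (simp add: nsq_def zero_prod_def)

lemma nsq_diff: "nsq (x - y) = nsq x + nsq y - 2 * inner x y"
  and nsq_add: "nsq (x + y) = nsq x + nsq y + 2 * inner x y"
  by (simp_all add: nsq_def inner_pair power2_eq_square algebra_simps)

text \<open>Lagrange's identity and the expansion of a vector w in terms of u, v via the Gram matrix.\<close>
lemma lagrange_identity: "nsq u * nsq v = (inner u v)^2 + (det2 u v)^2"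
  by (simp add: nsq_def det2_def inner_pair power2_eq_square algebra_simps)

lemma gram_expansion:
  "nsq w * (det2 u v)^2 = nsq v * (inner w u)^2 - 2*(inner u v)*(inner w u)*(inner w v) + nsq u * (inner w v)^2"
  by (simp add: nsq_def det2_def inner_pair power2_eq_square algebra_simps)

text \<open>For u nonzero, det2 u v = 0 exactly when v is a multiple of u.\<close>
lemma det2_eq_0_iff_span: assumes "u \<noteq> 0" shows "det2 u v = 0 \<longleftrightarrow> v \<in> span {u}"
proof
  assume d: "det2 u v = 0"
  have nu: "nsq u \<noteq> 0" using assms nsq_eq_0 by auto
  obtain u1 u2 v1 v2 where uv: "u = (u1,u2)" "v = (v1,v2)" by (cases u; cases v)
  have "u1 * v2 = u2 * v1" using d uv by (simp add: det2_def)
  then have "v = (inner v u / nsq u) *\<^sub>R u"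
    using nu uv unfolding nsq_def by (simp add: field_simps power2_eq_square)
  then show "v \<in> span {u}" unfolding span_singleton by blast
next
  assume "v \<in> span {u}"
  then show "det2 u v = 0" unfolding span_singleton by (auto simp: det2_def)
qed

text \<open>Two vectors form a basis iff their determinant is nonzero.\<close>
lemma independent_iff_det2: "(independent {u, v::real \<times> real} \<and> u \<noteq> v) \<longleftrightarrow> det2 u v \<noteq> 0"
proof (cases "u = 0 \<or> v = 0")
  case True
  then have "det2 u v = 0" by (auto simp: det2_def)
  moreover have "dependent {u, v}" using True by (intro dependent_zero) auto
  ultimately show ?thesis by simp
next
  case False
  have "det2 u v = - det2 v u" by (simp add: det2_def)
  then have "det2 u v \<noteq> 0 \<longleftrightarrow> u \<notin> span {v}" using det2_eq_0_iff_span[of v u] False by simp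
  moreover have "u \<notin> span {v} \<Longrightarrow> u \<noteq> v" using span_base by blast
  moreover have "independent {u, v} \<longleftrightarrow> u \<notin> span {v}" if "u \<noteq> v"
    using independent_insert[of u "{v}"] False that by simp
  ultimately show ?thesis by blast
qed

section \<open>Full-rank lattices in the plane\<close>

lemma lattice_basis:
  assumes "full_rank_lattice L"
  obtains u v where "det2 u v \<noteq> 0" "L = {of_int m *\<^sub>R u + of_int n *\<^sub>R v | m n. True}"
  using assms independent_iff_det2 unfolding full_rank_lattice_def by blast

text \<open>A lattice is closed under integral linear combinations.\<close>
lemma lattice_lincomb: assumes L: "full_rank_lattice L" and "x \<in> L" "y \<in> L"
  shows "of_int a *\<^sub>R x + of_int b *\<^sub>R y \<in> L"
proof -
  obtain u v where "det2 u v \<noteq> 0" and L: "L = {of_int m *\<^sub>R u + of_int n *\<^sub>R v | m n. True}"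
    by (rule lattice_basis[OF L])
  obtain m1 n1 m2 n2 where "x = of_int m1 *\<^sub>R u + of_int n1 *\<^sub>R v" "y = of_int m2 *\<^sub>R u + of_int n2 *\<^sub>R v"
    using assms(2,3) unfolding L by auto
  then have "of_int a *\<^sub>R x + of_int b *\<^sub>R y = of_int (a*m1 + b*m2) *\<^sub>R u + of_int (a*n1 + b*n2) *\<^sub>R v"
    by (simp add: scaleR_add_right scaleR_add_left ac_simps)
  then show ?thesis unfolding L mem_Collect_eq by (intro exI conjI TrueI)
qed

text \<open>Sums, differences and negatives of lattice vectors.\<close>
lemma lattice_add: "full_rank_lattice L \<Longrightarrow> x \<in> L \<Longrightarrow> y \<in> L \<Longrightarrow> x + y \<in> L"
  using lattice_lincomb[of L x y 1 1] by simp

lemma lattice_diff: "full_rank_lattice L \<Longrightarrow> x \<in> L \<Longrightarrow> y \<in> L \<Longrightarrow> x - y \<in> L"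
  using lattice_lincomb[of L x y 1 "-1"] by simp

lemma lattice_neg: "full_rank_lattice L \<Longrightarrow> x \<in> L \<Longrightarrow> - x \<in> L"
  using lattice_lincomb[of L x x "-1" 0] by simp

text \<open>A full-rank lattice has nonzero vectors.\<close>
lemma lattice_nonzero: assumes "full_rank_lattice L" shows "\<exists>x\<in>L. x \<noteq> 0"
proof -
  obtain u v where d: "det2 u v \<noteq> 0" and L: "L = {of_int m *\<^sub>R u + of_int n *\<^sub>R v | m n. True}"
    using lattice_basis[OF assms] by blast
  have "u = of_int 1 *\<^sub>R u + of_int 0 *\<^sub>R v" by simp
  then have "u \<in> L" using L by blast
  moreover have "u \<noteq> 0" using d by (auto simp: det2_def)
  ultimately show ?thesis by blast
qed

text \<open>Nonzero integer points have squared norm at least 1.\<close>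
lemma int_point_nsq_ge1: assumes "fst x \<in> \<int>" "snd x \<in> \<int>" "x \<noteq> 0" shows "1 \<le> nsq x"
proof -
  have "1 \<le> \<bar>fst x\<bar> \<or> 1 \<le> \<bar>snd x\<bar>" using assms Ints_nonzero_abs_ge1 by (cases x) (auto simp: zero_prod_def)
  then have "1 \<le> (fst x)^2 \<or> 1 \<le> (snd x)^2"
    using abs_le_square_iff[of 1 "fst x"] abs_le_square_iff[of 1 "snd x"] by simp
  then show ?thesis unfolding nsq_def by (meson add_increasing add_increasing2 zero_le_power2)
qed

text \<open>In a lattice of integer points the minimum is attained by the nonzero vectors' norms
  and is at least 1.\<close>
lemma int_lattice_min:
  assumes L: "full_rank_lattice L" and ints: "\<forall>x\<in>L. fst x \<in> \<int> \<and> snd x \<in> \<int>"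
  shows "1 \<le> lattice_min L" "\<And>x. x \<in> L \<Longrightarrow> x \<noteq> 0 \<Longrightarrow> lattice_min L \<le> norm x"
proof -
  let ?S = "{norm x | x. x \<in> L \<and> x \<noteq> 0}"
  have "?S \<noteq> {}" using lattice_nonzero[OF L] by auto
  moreover have "1 \<le> norm x" if "x \<in> L" "x \<noteq> 0" for x
    using int_point_nsq_ge1[of x] ints that by (simp add: norm_eq_sqrt_nsq)
  ultimately show "1 \<le> lattice_min L" unfolding lattice_min_def by (intro cInf_greatest) auto
  fix x assume "x \<in> L" "x \<noteq> 0"
  then have "norm x \<in> ?S" by blast
  then show "lattice_min L \<le> norm x" unfolding lattice_min_def by (rule cInf_lower) (rule bdd_belowI[of _ 0], auto)
qed

text \<open>The arithmetic core of the classification of minimal vectors: with Gram data c = (u,v),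
  a = (w,u), b = (w,v) of three minimal vectors of squared length m, the Gram expansion of w is
  incompatible with the bounds forced by minimality.\<close>
lemma gram_bound_contradiction: fixes m c a b :: real
  assumes "0 \<le> c" "2*c < m" "4*a^2 \<le> m^2" "4*b^2 \<le> m^2" "-4*(a*b) \<le> m^2"
    and "m*(m^2 - c^2) = m*a^2 - 2*c*a*b + m*b^2"
  shows False
proof -
  have m: "m > 0" using assms by linarith
  have "m*(4*a^2) \<le> m*m^2" "m*(4*b^2) \<le> m*m^2" using assms(3,4) m by (intro mult_left_mono; simp)+
  moreover have "(2*c)*(-4*(a*b)) \<le> (2*c)*m^2" using assms(5,1) by (intro mult_left_mono) auto
  moreover have "0 < m*((m-2*c)*(m+c))" using m assms(1,2) by (intro mult_pos_pos) auto
  moreover have "m*((m-2*c)*(m+c)) = m*m^2 - c*m^2 - 2*m*c^2" by (simp add: power2_eq_square algebra_simps)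
  moreover have "4*(m*(m^2 - c^2)) = m*(4*a^2) + (2*c)*(-4*(a*b)) + m*(4*b^2)"
    using assms(6) by (simp add: algebra_simps)
  ultimately show False by (simp add: algebra_simps)
qed

section \<open>Minimal vectors and the angle of a well-rounded sublattice of Z^2\<close>

locale wr_sublattice =
  fixes L assumes WR: "L \<in> WR_Z2"
begin

text \<open>The squared minimum.\<close>
definition msq :: real where "msq = (lattice_min L)^2"

lemma lattice: "full_rank_lattice L" using WR unfolding WR_Z2_def by blast

lemma int_coords: "x \<in> L \<Longrightarrow> fst x \<in> \<int> \<and> snd x \<in> \<int>" using WR unfolding WR_Z2_def by auto

lemma lattice_min_ge1: "1 \<le> lattice_min L" using int_lattice_min(1)[OF lattice] int_coords by blast

lemma msq_ge1: "1 \<le> msq" unfolding msq_def using lattice_min_ge1 by (simp add: one_le_power)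

text \<open>Every nonzero lattice vector has squared norm at least msq.\<close>
lemma nsq_ge_msq: assumes "x \<in> L" "x \<noteq> 0" shows "msq \<le> nsq x"
proof -
  have "lattice_min L \<le> norm x" using int_lattice_min(2)[OF lattice] int_coords assms by blast
  then have "(lattice_min L)^2 \<le> (norm x)^2" using lattice_min_ge1 by (intro power_mono) auto
  then show ?thesis unfolding msq_def norm_sq_nsq .
qed

text \<open>Minimal vectors are nonzero lattice vectors of squared norm msq, closed under negation.\<close>
lemma min_vector: assumes "x \<in> min_vectors L"
  shows "x \<in> L" "nsq x = msq" "x \<noteq> 0" "norm x = lattice_min L"
proof -
  show "x \<in> L" "norm x = lattice_min L" using assms unfolding min_vectors_def by auto
  then show "nsq x = msq" unfolding msq_def using norm_sq_nsq by metis
  then show "x \<noteq> 0" using msq_ge1 nsq_eq_0[of x] by auto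
qed

lemma min_vector_neg: "x \<in> min_vectors L \<Longrightarrow> - x \<in> min_vectors L"
  using lattice_neg[OF lattice] unfolding min_vectors_def by auto

text \<open>Since the minimal vectors span the plane, each of them has a non-collinear partner.\<close>
lemma min_vector_partner: assumes u: "u \<in> min_vectors L" shows "\<exists>v\<in>min_vectors L. det2 u v \<noteq> 0"
proof (rule ccontr)
  assume "\<not> ?thesis"
  then have "min_vectors L \<subseteq> span {u}" using det2_eq_0_iff_span[OF min_vector(3)[OF u]] by blast
  then have "span (min_vectors L) \<subseteq> span {u}" by (metis span_mono span_span)
  moreover have "span (min_vectors L) = UNIV" using WR unfolding WR_Z2_def well_rounded_def by blast
  ultimately have "(- snd u, fst u) \<in> span {u}" by auto
  then have "det2 u (- snd u, fst u) = 0" using det2_eq_0_iff_span[OF min_vector(3)[OF u]] by blast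
  then have "nsq u = 0" by (simp add: det2_def nsq_def power2_eq_square)
  then show False using min_vector(3)[OF u] nsq_eq_0 by blast
qed

text \<open>There are independent minimal vectors with nonnegative inner product.\<close>
lemma min_vector_pair: "\<exists>u\<in>min_vectors L. \<exists>v\<in>min_vectors L. det2 u v \<noteq> 0 \<and> 0 \<le> inner u v"
proof -
  have "min_vectors L \<noteq> {}"
  proof
    assume "min_vectors L = {}"
    then have "span (min_vectors L) = {0}" by simp
    moreover have "(1::real, 0::real) \<in> span (min_vectors L)"
      using WR unfolding WR_Z2_def well_rounded_def by simp
    ultimately show False by (simp add: zero_prod_def)
  qed
  then obtain u where u: "u \<in> min_vectors L" by blast
  then obtain v where v: "v \<in> min_vectors L" "det2 u v \<noteq> 0" using min_vector_partner by blast
  show ?thesis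
  proof (cases "0 \<le> inner u v")
    case True then show ?thesis using u v by blast
  next
    case False
    have "det2 u (- v) \<noteq> 0" using v by (simp add: det2_def)
    then show ?thesis using u min_vector_neg[OF v(1)] False by force
  qed
qed

text \<open>msq is an integer, being the squared norm of an integer point.\<close>
lemma msq_Ints: assumes "u \<in> min_vectors L" shows "msq \<in> \<int>"
  using int_coords[OF min_vector(1)[OF assms]] min_vector(2)[OF assms] by (metis Ints_add Ints_power nsq_def)

text \<open>Two independent minimal vectors make an angle of more than 60 degrees: the difference
  is a nonzero lattice vector, and equality would make sqrt 3 rational.\<close>
lemma twice_inner_lt: assumes u: "u \<in> min_vectors L" and v: "v \<in> min_vectors L"
  and d: "det2 u v \<noteq> 0" shows "2 * inner u v < msq"
proof -
  have "u - v \<in> L" using lattice_diff[OF lattice min_vector(1)[OF u] min_vector(1)[OF v]] .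
  moreover have "u - v \<noteq> 0" using d by (auto simp: det2_def)
  ultimately have "msq \<le> nsq (u - v)" by (rule nsq_ge_msq)
  then have le: "2 * inner u v \<le> msq" unfolding nsq_diff min_vector(2)[OF u] min_vector(2)[OF v] by simp
  have "2 * inner u v \<noteq> msq"
  proof
    assume e: "2 * inner u v = msq"
    have "msq * msq = (inner u v)^2 + (det2 u v)^2"
      using lagrange_identity[of u v] min_vector(2)[OF u] min_vector(2)[OF v] by simp
    then have "(2 * det2 u v)^2 = 3 * msq^2" unfolding e[symmetric] by (simp add: power2_eq_square algebra_simps)
    moreover have "det2 u v \<in> \<int>" using int_coords min_vector(1) u v by (simp add: det2_def)
    ultimately obtain M D where MD: "msq = of_int M" "det2 u v = of_int D" "(2 * of_int D)^2 = 3 * (of_int M :: real)^2"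
      using msq_Ints[OF u] by (elim Ints_cases) auto
    then have "(2 * D)^2 = 3 * M^2" by (metis (mono_tags) of_int_eq_iff of_int_mult of_int_numeral of_int_power)
    then have "M = 0" by (rule sq_eq_three_sq)
    then show False using MD msq_ge1 by simp
  qed
  then show ?thesis using le by simp
qed

text \<open>A well-rounded sublattice of Z^2 has exactly the four minimal vectors +-u, +-v.\<close>
lemma min_vectors_classify: assumes u: "u \<in> min_vectors L" and v: "v \<in> min_vectors L"
  and d: "det2 u v \<noteq> 0" and c: "0 \<le> inner u v" and w: "w \<in> min_vectors L"
  shows "w = u \<or> w = - u \<or> w = v \<or> w = - v"
proof (rule ccontr)
  assume nw: "\<not> ?thesis"
  have wL: "w \<in> L" and uL: "u \<in> L" and vL: "v \<in> L" using min_vector(1) u v w by auto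
  have nu: "nsq u = msq" and nv: "nsq v = msq" and nw': "nsq w = msq" using min_vector(2) u v w by auto
  have bound: "\<bar>2 * inner w x\<bar> \<le> msq" if x: "x \<in> L" "nsq x = msq" "w \<noteq> x" "w \<noteq> - x" for x
  proof -
    have "msq \<le> nsq (w - x)" "msq \<le> nsq (w + x)"
      using nsq_ge_msq lattice_diff[OF lattice wL x(1)] lattice_add[OF lattice wL x(1)] x(3,4)
      by (auto simp: add_eq_0_iff2)
    then show ?thesis unfolding nsq_diff nsq_add x(2) nw' by linarith
  qed
  have a: "\<bar>2 * inner w u\<bar> \<le> msq" and b: "\<bar>2 * inner w v\<bar> \<le> msq" using bound nw uL vL nu nv by auto
  have "4 * (inner w u)^2 \<le> msq^2" "4 * (inner w v)^2 \<le> msq^2"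
    using a b abs_le_square_iff[of "2 * inner w u" msq] abs_le_square_iff[of "2 * inner w v" msq] msq_ge1
    by (simp_all add: power_mult_distrib)
  moreover have "\<bar>2 * inner w u\<bar> * \<bar>2 * inner w v\<bar> \<le> msq * msq" using a b by (intro mult_mono) auto
  then have "- 4 * (inner w u * inner w v) \<le> msq^2"
    using abs_ge_minus_self[of "inner w u * inner w v"] by (simp add: abs_mult power2_eq_square)
  moreover have "(det2 u v)^2 = msq^2 - (inner u v)^2" using lagrange_identity[of u v] nu nv by (simp add: power2_eq_square)
  then have "msq * (msq^2 - (inner u v)^2) = msq * (inner w u)^2 - 2 * inner u v * inner w u * inner w v + msq * (inner w v)^2"
    using gram_expansion[of w u v] nu nv nw' by simp
  ultimately show False using gram_bound_contradiction[OF c twice_inner_lt[OF u v d]] by blast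
qed

text \<open>The angle between minimal vectors in terms of their inner product.\<close>
lemma vec_angle_min_vectors:
  "x \<in> min_vectors L \<Longrightarrow> y \<in> min_vectors L \<Longrightarrow> vec_angle x y = arccos (inner x y / msq)"
  unfolding vec_angle_def msq_def using min_vector(4) by (simp add: power2_eq_square)

text \<open>theta is well defined: it is the angle of any pair of independent minimal vectors with
  nonnegative inner product.  Other pairs are +-u, +-v and give the same or the supplementary
  angle, the latter exceeding pi/2 unless u and v are orthogonal.\<close>
lemma theta_eq: assumes u: "u \<in> min_vectors L" and v: "v \<in> min_vectors L"
  and d: "det2 u v \<noteq> 0" and c: "0 \<le> inner u v"
  shows "lattice_theta L = arccos (inner u v / msq)"
proof -
  let ?c = "inner u v"
  have c2: "2 * ?c < msq" using twice_inner_lt[OF u v d] .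
  have m0: "msq > 0" using msq_ge1 by simp
  have c01: "0 \<le> ?c / msq" "?c / msq \<le> 1" using c c2 m0 by (auto simp: field_simps)
  show ?thesis unfolding lattice_theta_def
  proof (rule the_equality)
    show "\<exists>u'\<in>min_vectors L. \<exists>v'\<in>min_vectors L. independent {u', v'} \<and> u' \<noteq> v' \<and>
        arccos (?c / msq) = vec_angle u' v' \<and> arccos (?c / msq) \<le> pi / 2"
    proof (rule bexI[OF _ u], rule bexI[OF _ v], intro conjI)
      show "independent {u, v}" "u \<noteq> v" using independent_iff_det2[of u v] d by auto
      show "arccos (?c / msq) = vec_angle u v" using vec_angle_min_vectors[OF u v] by simp
      show "arccos (?c / msq) \<le> pi / 2" using arccos_le_pi2[OF c01] .
    qed
  next
    fix t assume "\<exists>u'\<in>min_vectors L. \<exists>v'\<in>min_vectors L. independent {u', v'} \<and> u' \<noteq> v' \<and>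
        t = vec_angle u' v' \<and> t \<le> pi / 2"
    then obtain u' v' where u': "u' \<in> min_vectors L" and v': "v' \<in> min_vectors L"
      and i: "independent {u', v'} \<and> u' \<noteq> v'" and t0: "t = vec_angle u' v'" and t2: "t \<le> pi / 2"
      by blast
    have d': "det2 u' v' \<noteq> 0" using i independent_iff_det2 by blast
    have t: "t = arccos (inner u' v' / msq)" "t \<le> pi / 2" using t0 t2 vec_angle_min_vectors[OF u' v'] by simp_all
    have "inner u' v' = ?c \<or> inner u' v' = - ?c"
      using min_vectors_classify[OF u v d c u'] min_vectors_classify[OF u v d c v'] d'
      by (elim disjE) (simp_all add: inner_commute det2_def algebra_simps)
    then show "t = arccos (?c / msq)"
    proof
      assume e: "inner u' v' = - ?c"
      have b: "-1 \<le> - ?c / msq" "- ?c / msq \<le> 1" using c01 by auto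
      have "cos t = - ?c / msq" using t(1) e b by simp
      moreover have "0 \<le> t" using t(1) e arccos_lbound[OF b] by simp
      ultimately have "0 \<le> - ?c / msq" using t(2) cos_ge_zero[of t] by simp
      then have "?c = 0" using c m0 by (simp add: divide_le_0_iff)
      then show ?thesis using t(1) e by simp
    qed (use t in simp)
  qed
qed

text \<open>theta = arccos x with 0 <= x < 1/2, i.e. pi/3 < theta <= pi/2.\<close>
lemma theta_arccos: "\<exists>x. 0 \<le> x \<and> 2 * x < 1 \<and> lattice_theta L = arccos x"
proof -
  obtain u v where uv: "u \<in> min_vectors L" "v \<in> min_vectors L" "det2 u v \<noteq> 0" "0 \<le> inner u v"
    using min_vector_pair by blast
  have "2 * inner u v < msq" using twice_inner_lt uv by blast
  moreover have "msq > 0" using msq_ge1 by simp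
  ultimately show ?thesis using theta_eq[OF uv] uv(4)
    by (intro exI[of _ "inner u v / msq"]) (auto simp: field_simps)
qed

end

section \<open>Every class C(p,q) is nonempty\<close>

text \<open>Unpacking membership in S: p^2 + r^2 = q^2 with 2r < q and r < p (r = 0 only for p/q = 1).\<close>
lemma S_pairs_D: assumes "(p,q) \<in> S_pairs"
  shows "0 < p \<and> 0 < q \<and> coprime p q \<and> (\<exists>r::nat. p^2 + r^2 = q^2 \<and> 2*r < q \<and> r < p)"
proof (cases "(p,q) = (1,1)")
  case True then show ?thesis by (intro conjI exI[of _ 0]) auto
next
  case False
  then have h: "0 < p" "0 < q" "coprime p q" "sqrt 3 / 2 < real p / real q" "real p / real q < 1"
    and "\<exists>r::nat. q^2 - p^2 = r^2" using assms unfolding S_pairs_def by auto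
  then obtain r :: nat where r: "q^2 - p^2 = r^2" by blast
  have "p < q" using h(2,5) by (simp add: divide_less_eq)
  then have "p^2 < q^2" by (simp add: power_strict_mono)
  then have pr: "p^2 + r^2 = q^2" using r by simp
  have "sqrt 3 * real q < 2 * real p" using h(2,4) by (simp add: field_simps)
  then have "(sqrt 3 * real q)^2 < (2 * real p)^2" by (intro power_strict_mono) auto
  then have "real (3 * q^2) < real (4 * p^2)" by (simp add: power_mult_distrib)
  then have s: "3 * q^2 < 4 * p^2" by (simp only: of_nat_less_iff)
  have "(2*r)^2 < q^2" using s pr by (simp add: power_mult_distrib)
  then have "2 * r < q" by (rule power_less_imp_less_base) simp
  moreover have "r^2 < p^2" using s pr by linarith
  then have "r < p" by (rule power_less_imp_less_base) simp
  ultimately show ?thesis using h pr by blast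
qed

text \<open>The converse: such p, q, r with r > 0 give an element of S.\<close>
lemma S_pairs_I: fixes p q r :: nat
  assumes "0 < r" "p^2 + r^2 = q^2" "2*r < q" "coprime p q" "0 < p"
  shows "(p,q) \<in> S_pairs"
proof -
  have q0: "0 < q" using assms(3) by simp
  have "0 < r^2" using assms(1) by simp
  then have "p^2 < q^2" using assms(2) by linarith
  then have "p < q" by (rule power_less_imp_less_base) simp
  then have lt1: "real p / real q < 1" using q0 by simp
  have "(2*r)^2 < q^2" using assms(3) by (intro power_strict_mono) auto
  then have "3 * q^2 < 4 * p^2" using assms(2) by (simp add: power_mult_distrib)
  then have "real (3 * q^2) < real (4 * p^2)" by (simp only: of_nat_less_iff)
  then have "(sqrt 3 * real q)^2 < (2 * real p)^2" by (simp add: power_mult_distrib)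
  then have "sqrt 3 * real q < 2 * real p" by (rule power_less_imp_less_base) simp
  then have "sqrt 3 / 2 < real p / real q" using q0 by (simp add: field_simps)
  moreover have "q^2 - p^2 = r^2" using assms(2) by simp
  ultimately show ?thesis unfolding S_pairs_def using assms(4,5) q0 lt1 by blast
qed

text \<open>The binary quadratic form q^2(i^2+j^2) + 2ijqr, 0 <= 2r <= q, takes no nonzero value below q^2.\<close>
lemma quadratic_form_bound: fixes q r i j :: int
  assumes "0 < q" "0 \<le> r" "2*r \<le> q" "i \<noteq> 0 \<or> j \<noteq> 0"
  shows "q^2 \<le> q^2*(i^2+j^2) + 2*(i*j)*q*r"
proof (cases "0 \<le> i*j")
  case True
  have "0 < i^2 + j^2" using assms(4) by (simp add: sum_power2_gt_zero_iff)
  then have "1 \<le> i^2 + j^2" by simp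
  then have "q^2 * 1 \<le> q^2 * (i^2+j^2)" by (intro mult_left_mono) auto
  moreover have "0 \<le> 2*(i*j)*q*r" using True assms by simp
  ultimately show ?thesis by simp
next
  case False
  then have ij: "i*j < 0" by simp
  have "(i*j)*q \<le> (i*j)*(2*r)" using ij assms(3) by (intro mult_left_mono_neg) auto
  then have "(i*j)*q*q \<le> (i*j)*(2*r)*q" using assms(1) by (intro mult_right_mono) auto
  then have 1: "q^2*(i*j) \<le> 2*(i*j)*q*r" by (simp add: power2_eq_square algebra_simps)
  have "0 \<le> (i+j)^2" by simp
  then have "1 \<le> i^2 + j^2 + i*j" using ij by (simp add: power2_eq_square algebra_simps)
  then have "q^2 * 1 \<le> q^2 * (i^2 + j^2 + i*j)" by (intro mult_left_mono) auto
  then show ?thesis using 1 by (simp add: algebra_simps)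
qed

text \<open>For a Pythagorean triple (p,r,q) with 2r < q, the lattice spanned by (q,0) and (r,p) is a
  well-rounded sublattice of Z^2 whose angle has sine p/q.\<close>
locale pyth_lattice =
  fixes p q r :: nat
  assumes p0: "0 < p" and q0: "0 < q" and pyth: "p^2 + r^2 = q^2" and small: "2*r < q"
begin

text \<open>The basis (q,0), (r,p) of the lattice.\<close>
definition "bu = (real q, 0::real)"
definition "bv = (real r, real p)"
definition "Lpq = {of_int i *\<^sub>R bu + of_int j *\<^sub>R bv | i j. True}"

lemma pyth_real: "real p ^ 2 + real r ^ 2 = real q ^ 2"
  using pyth by (metis of_nat_add of_nat_power)

lemma det_basis: "det2 bu bv \<noteq> 0" using p0 q0 by (simp add: det2_def bu_def bv_def)

lemma lattice: "full_rank_lattice Lpq"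
  unfolding full_rank_lattice_def Lpq_def using det_basis independent_iff_det2 by blast

lemma mem_Lpq: "x \<in> Lpq \<longleftrightarrow> (\<exists>i j. x = (of_int (i * int q + j * int r), of_int (j * int p)))"
  unfolding Lpq_def by (auto simp: bu_def bv_def)

text \<open>The minimum of the lattice is q, by the bound on the quadratic form.\<close>
lemma nsq_ge: assumes "x \<in> Lpq" "x \<noteq> 0" shows "(real q)^2 \<le> nsq x"
proof -
  obtain i j where x: "x = (of_int (i * int q + j * int r), of_int (j * int p))" using assms(1) mem_Lpq by blast
  have ij: "i \<noteq> 0 \<or> j \<noteq> 0" using assms(2) x by (auto simp: zero_prod_def)
  have pyth_int: "int p ^ 2 + int r ^ 2 = int q ^ 2" using pyth by (metis of_nat_add of_nat_power)
  have "nsq x = of_int ((i * int q + j * int r)^2 + (j * int p)^2)" using x by (simp add: nsq_def)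
  also have "(i * int q + j * int r)^2 + (j * int p)^2 = (int q)^2*(i^2+j^2) + 2*(i*j)*int q*int r"
    using pyth_int by (simp add: power2_eq_square algebra_simps) (metis distrib_left mult.commute mult.left_commute)
  finally have "nsq x = of_int ((int q)^2*(i^2+j^2) + 2*(i*j)*int q*int r)" .
  moreover have "(int q)^2 \<le> (int q)^2*(i^2+j^2) + 2*(i*j)*int q*int r"
    using quadratic_form_bound[of "int q" "int r" i j] q0 small ij by simp
  ultimately show ?thesis by (metis of_int_le_iff of_int_of_nat_eq of_int_power)
qed

lemma basis_mem: "bu \<in> Lpq" "bv \<in> Lpq"
  unfolding Lpq_def mem_Collect_eq
  by (intro exI[of _ 1] exI[of _ 0] conjI TrueI; simp) (intro exI[of _ 0] exI[of _ 1] conjI TrueI; simp)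

lemma norm_basis: "norm bu = real q" "norm bv = real q"
  using pyth_real by (simp_all add: norm_eq_sqrt_nsq nsq_def bu_def bv_def add.commute)

lemma lattice_min: "lattice_min Lpq = real q"
  unfolding lattice_min_def
proof (rule cInf_eq_minimum)
  have "bu \<noteq> 0" using q0 by (simp add: bu_def zero_prod_def)
  then have "norm bu \<in> {norm x |x. x \<in> Lpq \<and> x \<noteq> 0}" using basis_mem by blast
  then show "real q \<in> {norm x |x. x \<in> Lpq \<and> x \<noteq> 0}" using norm_basis by simp
next
  fix y assume "y \<in> {norm x |x. x \<in> Lpq \<and> x \<noteq> 0}"
  then obtain x where "y = norm x" "x \<in> Lpq" "x \<noteq> 0" by blast
  then show "real q \<le> y" using nsq_ge norm_eq_sqrt_nsq by (metis of_nat_0_le_iff real_le_rsqrt)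
qed

lemma min_vectors_basis: "bu \<in> min_vectors Lpq" "bv \<in> min_vectors Lpq"
  unfolding min_vectors_def using basis_mem norm_basis lattice_min by simp_all

lemma span_basis: "span {bu, bv} = UNIV"
proof -
  have "z \<in> span {bu, bv}" for z
  proof -
    obtain z1 z2 where z: "z = (z1, z2)" by (cases z)
    define b where "b = z2 / real p"
    define a where "a = (z1 - b * real r) / real q"
    have "z = a *\<^sub>R bu + b *\<^sub>R bv" using p0 q0 z by (simp add: a_def b_def bu_def bv_def field_simps)
    then show ?thesis by (simp add: span_add span_base span_scale)
  qed
  then show ?thesis by auto
qed

lemma WR: "Lpq \<in> WR_Z2"
proof -
  have "span {bu, bv} \<subseteq> span (min_vectors Lpq)" using min_vectors_basis by (intro span_mono) auto
  then have "well_rounded Lpq" unfolding well_rounded_def using span_basis by auto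
  moreover have "Lpq \<subseteq> {(of_int a, of_int b) | a b. True}" using mem_Lpq by blast
  ultimately show ?thesis unfolding WR_Z2_def using lattice by blast
qed

lemma sin_theta: "sin (lattice_theta Lpq) = real p / real q"
proof -
  interpret w: wr_sublattice Lpq by unfold_locales (rule WR)
  have "lattice_theta Lpq = arccos (inner bu bv / w.msq)"
    using w.theta_eq[OF min_vectors_basis det_basis] by (simp add: bu_def bv_def)
  also have "inner bu bv / w.msq = real r / real q"
    unfolding w.msq_def lattice_min using q0 by (simp add: bu_def bv_def power2_eq_square)
  finally have t: "lattice_theta Lpq = arccos (real r / real q)" .
  have b: "-1 \<le> real r / real q" "real r / real q \<le> 1" using small q0 by (auto simp: field_simps)
  have "sin (lattice_theta Lpq) = sqrt (1 - (real r / real q)^2)" unfolding t using sin_arccos[OF b] .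
  also have "1 - (real r / real q)^2 = (real p / real q)^2"
    using pyth_real q0 by (simp add: field_simps power2_eq_square)
  finally show ?thesis by simp
qed

lemma in_Cls: "Lpq \<in> Cls p q" unfolding Cls_def using WR sin_theta by blast

end

text \<open>Each class C(p,q) with p/q in S is nonempty.\<close>
lemma Cls_nonempty: assumes "(p,q) \<in> S_pairs" shows "Cls p q \<noteq> {}"
proof -
  obtain r where "0 < p" "0 < q" "p^2 + r^2 = q^2" "2*r < q" using S_pairs_D[OF assms] by blast
  then interpret pyth_lattice p q r by unfold_locales
  show ?thesis using in_Cls by blast
qed

section \<open>The bijection psi between C2 and P\<close>

lemma coprime_fraction_eq: fixes p q p' q' :: nat
  assumes "coprime p q" "coprime p' q'" "p * q' = p' * q" "0 < q" "0 < q'"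
  shows "p = p' \<and> q = q'"
proof -
  have "q dvd q'" using assms(1,3) by (metis coprime_commute coprime_dvd_mult_right_iff dvd_triv_right)
  moreover have "q' dvd q" using assms(2,3) by (metis coprime_commute coprime_dvd_mult_right_iff dvd_triv_right)
  ultimately have "q = q'" by (rule dvd_antisym)
  then show ?thesis using assms(3,4) by simp
qed

text \<open>sin theta determines the class, so distinct elements of S give distinct classes.\<close>
lemma Cls_inj: assumes "(p,q) \<in> S_pairs" "(p',q') \<in> S_pairs" "Cls p q = Cls p' q'"
  shows "p = p' \<and> q = q'"
proof -
  obtain L where "L \<in> Cls p q" using Cls_nonempty[OF assms(1)] by blast
  then have "real p / real q = real p' / real q'" using assms(3) unfolding Cls_def by auto
  moreover have "0 < q" "0 < q'" "coprime p q" "coprime p' q'" using S_pairs_D assms(1,2) by blast+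
  ultimately have "real (p * q') = real (p' * q)" by (simp add: field_simps)
  then show ?thesis using coprime_fraction_eq \<open>0 < q\<close> \<open>0 < q'\<close> \<open>coprime p q\<close> \<open>coprime p' q'\<close>
    by (metis of_nat_eq_iff)
qed

text \<open>The triple of the definition of psi, computed from p and q.\<close>
definition psi_triple :: "nat \<Rightarrow> nat \<Rightarrow> int \<times> int \<times> int" where
  "psi_triple p q = (if even p then (floor (sqrt (real q ^ 2 - real p ^ 2)), int p, int q)
                     else (int p, floor (sqrt (real q ^ 2 - real p ^ 2)), int q))"

text \<open>With the third side r it is (r,p,q) or (p,r,q) according to the parity of p.\<close>
lemma psi_triple_eq: assumes "p^2 + r^2 = q^2"
  shows "psi_triple p q = (if even p then (int r, int p, int q) else (int p, int r, int q))"
proof -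
  have "real q ^ 2 - real p ^ 2 = real r ^ 2" using assms by (metis add_diff_cancel_left' of_nat_add of_nat_power)
  then show ?thesis unfolding psi_triple_def by simp
qed

text \<open>psi is well defined on classes.\<close>
lemma psi_Cls: assumes "(p,q) \<in> S_pairs" shows "psi (Cls p q) = psi_triple p q"
  unfolding psi_def psi_triple_def[symmetric]
proof (rule the_equality)
  show "\<exists>p' q'. (p', q') \<in> S_pairs \<and> Cls p q = Cls p' q' \<and> psi_triple p q = psi_triple p' q'"
    using assms by blast
next
  fix t assume "\<exists>p' q'. (p', q') \<in> S_pairs \<and> Cls p q = Cls p' q' \<and> t = psi_triple p' q'"
  then show "t = psi_triple p q" using Cls_inj[OF assms] by metis
qed

text \<open>A sum of two odd squares is 2 mod 4, hence not a square.\<close>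
lemma odd_squares_sum: fixes p r q :: nat assumes "odd p" "odd r" "p^2 + r^2 = q^2" shows False
proof -
  obtain a b where ab: "p = 2*a+1" "r = 2*b+1" using assms(1,2) oddE by metis
  have e: "q^2 = 4*(a^2+a+b^2+b) + 2" using assms(3) ab by (simp add: power2_eq_square algebra_simps)
  then have "even (q^2)" by simp
  then have "even q" by simp
  then obtain c where "q = 2*c" by blast
  then have "4*(c^2) = 4*(a^2+a+b^2+b) + 2" using e by (simp add: power2_eq_square)
  then show False by presburger
qed

text \<open>psi_triple maps S into P.\<close>
lemma psi_triple_PP: assumes s: "(p,q) \<in> S_pairs" shows "psi_triple p q \<in> PP"
proof -
  obtain r where h: "0 < p" "0 < q" "coprime p q" "p^2 + r^2 = q^2" "2*r < q" "r < p"
    using S_pairs_D[OF s] by blast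
  have "gcd p (gcd r q) = gcd r (gcd p q)" by (rule gcd.left_commute)
  then have g: "gcd p (gcd r q) = 1" "gcd r (gcd p q) = 1" using h(3) by simp_all
  have pyth_int: "int p ^ 2 + int r ^ 2 = int q ^ 2" using h(4) by (metis of_nat_add of_nat_power)
  have small: "2 * min (int r) (int p) < int q" "2 * min (int p) (int r) < int q" using h(5) by linarith+
  show ?thesis
  proof (cases "r = 0")
    case True
    then have "p = 1" "q = 1" using h(3,4) by simp_all
    then show ?thesis using psi_triple_eq[OF h(4)] True unfolding PP_def by simp
  next
    case False
    then show ?thesis
    proof (cases "even p")
      case True
      have "(int r, int p, int q) \<in> PPT"
        unfolding PPT_def using h False True pyth_int g by (auto simp: add.commute)
      then show ?thesis using psi_triple_eq[OF h(4)] True small unfolding PP_def by auto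
    next
      case p_odd: False
      then have "even r" using odd_squares_sum h(4) by blast
      then have "(int p, int r, int q) \<in> PPT"
        unfolding PPT_def using h False pyth_int g by auto
      then show ?thesis using psi_triple_eq[OF h(4)] p_odd small unfolding PP_def by auto
    qed
  qed
qed

text \<open>The larger leg of a primitive triple is coprime to the hypotenuse.\<close>
lemma primitive_max_leg_coprime: fixes x y z :: int
  assumes "x^2 + y^2 = z^2" "gcd x (gcd y z) = 1" shows "coprime (max x y) z"
proof -
  let ?g = "gcd (max x y) z"
  have "min x y ^ 2 = z^2 - max x y ^ 2" using assms(1) by (cases "x \<le> y") auto
  moreover have "?g^2 dvd z^2 - max x y ^ 2" by (simp add: dvd_diff)
  ultimately have "?g^2 dvd min x y ^ 2" by simp
  then have "?g dvd min x y" using pow_divides_pow_iff[of 2] by simp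
  then have "?g dvd x" "?g dvd y" by (cases "x \<le> y"; simp add: min_def max_def split: if_splits)+
  then have "?g dvd gcd x (gcd y z)" by simp
  then show ?thesis using assms(2) by (simp add: coprime_iff_gcd_eq_1)
qed

text \<open>Every element of P arises: take p the larger leg and r the smaller one.\<close>
lemma PP_psi_triple: assumes t: "t \<in> PP" shows "\<exists>p q. (p,q) \<in> S_pairs \<and> psi_triple p q = t"
proof (cases "t = (1,0,1)")
  case True
  have "(1, 1) \<in> S_pairs" "psi_triple 1 1 = (1,0,1)" unfolding S_pairs_def psi_triple_def by simp_all
  then show ?thesis using True by blast
next
  case False
  obtain x y z where tx: "t = (x,y,z)" by (cases t)
  have h: "0<x" "0<y" "0<z" "even y" "gcd x (gcd y z) = 1" "x^2+y^2=z^2" "2 * min x y < z"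
    using t False tx unfolding PP_def PPT_def by auto
  have "odd x" using ppt_odd_first[OF h(6,4,5)] .
  then have "x \<noteq> y" using h(4) by auto
  define p r q where "p = nat (max x y)" "r = nat (min x y)" "q = nat z"
  have ip: "int p = max x y" "int r = min x y" "int q = z" using h(1-3) unfolding p_r_q_def by auto
  have "int (p^2 + r^2) = int (q^2)" using h(6) ip by (cases "x \<le> y") (simp_all add: max_def min_def add.commute)
  then have e: "p^2 + r^2 = q^2" by (simp only: of_nat_eq_iff)
  have "coprime (int p) (int q)" using primitive_max_leg_coprime[OF h(6,5)] ip by simp
  moreover have "0 < int r" "2 * int r < int q" "0 < int p" using ip h(1,2,7) by auto
  ultimately have s: "(p,q) \<in> S_pairs" using S_pairs_I[OF _ e] by simp
  have "psi_triple p q = t"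
  proof (cases "x < y")
    case True
    then have "int p = y" "int r = x" using ip by auto
    moreover have "even p" using \<open>int p = y\<close> h(4) by (metis even_of_nat)
    ultimately show ?thesis using psi_triple_eq[OF e] ip(3) tx by simp
  next
    case False
    then have "int p = x" "int r = y" using ip \<open>x \<noteq> y\<close> by auto
    moreover have "odd p" using \<open>int p = x\<close> \<open>odd x\<close> by (metis even_of_nat)
    ultimately show ?thesis using psi_triple_eq[OF e] ip(3) tx by simp
  qed
  then show ?thesis using s by blast
qed

text \<open>p and q can be read off psi_triple p q: q is the hypotenuse and p the larger leg.\<close>
lemma psi_triple_inj:
  assumes "(p,q) \<in> S_pairs" "(p',q') \<in> S_pairs" "psi_triple p q = psi_triple p' q'"
  shows "p = p' \<and> q = q'"
proof -
  have read: "snd (snd (psi_triple p q)) = int q \<and> max (fst (psi_triple p q)) (fst (snd (psi_triple p q))) = int p"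
    if pq: "(p,q) \<in> S_pairs" for p q
  proof -
    obtain r where "p^2 + r^2 = q^2" "r < p" using S_pairs_D[OF pq] by blast
    then show ?thesis by (simp add: psi_triple_eq max_def)
  qed
  show ?thesis using read[OF assms(1)] read[OF assms(2)] assms(3) by (metis of_nat_eq_iff)
qed

lemma psi_bij: "bij_betw psi C2 PP"
proof (rule bij_betw_imageI)
  show "inj_on psi C2"
  proof
    fix a b assume "a \<in> C2" "b \<in> C2" "psi a = psi b"
    then obtain p q p' q' where "(p,q) \<in> S_pairs" "a = Cls p q" "(p',q') \<in> S_pairs" "b = Cls p' q'"
      "psi_triple p q = psi_triple p' q'" unfolding C2_def using psi_Cls by auto
    then show "a = b" using psi_triple_inj by blast
  qed
  show "psi ` C2 = PP"
  proof
    show "psi ` C2 \<subseteq> PP" unfolding C2_def using psi_Cls psi_triple_PP by auto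
    show "PP \<subseteq> psi ` C2"
    proof
      fix t assume "t \<in> PP"
      then obtain p q where "(p,q) \<in> S_pairs" "psi (Cls p q) = t" using PP_psi_triple psi_Cls by blast
      then show "t \<in> psi ` C2" unfolding C2_def by blast
    qed
  qed
qed

section \<open>Transport of monoid structure along a bijective homomorphism\<close>

lemma word_prod_simps [simp]: "word_prod f e [] = e" "word_prod f e (x # xs) = f x (word_prod f e xs)"
  by (simp_all add: word_prod_def)

text \<open>If h maps (M, f, e) bijectively and homomorphically onto (N, g, u), then every structural
  property of N below (monoid, free, infinitely generated, non-commutative) holds for M.\<close>
locale monoid_transport =
  fixes M :: "'a set" and f e and N :: "'b set" and g u h
  assumes bij: "bij_betw h M N" and unit: "h e = u" and unit_mem: "e \<in> M"
    and closed: "\<And>a b. a \<in> M \<Longrightarrow> b \<in> M \<Longrightarrow> f a b \<in> M"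
    and hom: "\<And>a b. a \<in> M \<Longrightarrow> b \<in> M \<Longrightarrow> h (f a b) = g (h a) (h b)"
begin

lemma inj: "inj_on h M" and into: "a \<in> M \<Longrightarrow> h a \<in> N"
  using bij by (auto simp: bij_betw_def)

definition "h_inv = the_inv_into M h"

lemma h_inv_mem: "b \<in> N \<Longrightarrow> h_inv b \<in> M" and h_h_inv: "b \<in> N \<Longrightarrow> h (h_inv b) = b"
  unfolding h_inv_def using bij bij_betw_the_inv_into bij_betwE f_the_inv_into_f_bij_betw by fastforce+

lemma word_prod_mem: "set xs \<subseteq> M \<Longrightarrow> word_prod f e xs \<in> M"
  by (induction xs) (auto simp: unit_mem closed)

text \<open>h is compatible with products of words.\<close>
lemma h_word_prod: "set xs \<subseteq> M \<Longrightarrow> h (word_prod f e xs) = word_prod g u (map h xs)"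
  by (induction xs) (auto simp: unit hom word_prod_mem)

lemma monoid: assumes mN: "is_monoid N g u" shows "is_monoid M f e"
  unfolding is_monoid_def
proof (intro conjI ballI)
  have uN: "\<And>x. x \<in> N \<Longrightarrow> g u x = x \<and> g x u = x"
    and aN: "\<And>x y z. x \<in> N \<Longrightarrow> y \<in> N \<Longrightarrow> z \<in> N \<Longrightarrow> g (g x y) z = g x (g y z)"
    using mN unfolding is_monoid_def by blast+
  have eq: "x = y" if "x \<in> M" "y \<in> M" "h x = h y" for x y using inj that by (auto dest: inj_onD)
  show "e \<in> M" by (rule unit_mem)
  fix a b assume a: "a \<in> M" and b: "b \<in> M"
  show "f a b \<in> M" using closed a b .
  show "f e a = a" "f a e = a" using eq closed hom unit uN into a unit_mem by simp_all
  fix c assume c: "c \<in> M"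
  show "f (f a b) c = f a (f b c)" using eq closed hom aN into a b c by simp
qed

text \<open>A free basis of N pulls back along h to a free basis of M.\<close>
lemma free_basis: assumes X: "free_basis N g u X" shows "free_basis M f e (h_inv ` X)"
  unfolding free_basis_def
proof (intro conjI ballI)
  have XN: "X \<subseteq> N" using X unfolding free_basis_def by blast
  show "h_inv ` X \<subseteq> M" using XN h_inv_mem by blast
  have h_basis: "h x \<in> X" if "x \<in> h_inv ` X" for x using that XN h_h_inv by auto
  fix a assume a: "a \<in> M"
  have words_eq: "xs = ys" if "set xs \<subseteq> h_inv ` X" "set ys \<subseteq> h_inv ` X"
    "word_prod f e xs = a" "word_prod f e ys = a" for xs ys
  proof -
    have "set xs \<subseteq> M" "set ys \<subseteq> M" using that(1,2) XN h_inv_mem by blast+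
    moreover have "set (map h xs) \<subseteq> X" "set (map h ys) \<subseteq> X" using that(1,2) h_basis by auto
    ultimately have "map h xs = map h ys"
      using X into[OF a] h_word_prod that(3,4) unfolding free_basis_def by metis
    then show ?thesis using inj \<open>set xs \<subseteq> M\<close> \<open>set ys \<subseteq> M\<close> by (meson inj_on_map_eq_map inj_on_subset Un_least)
  qed
  obtain ys where ys: "set ys \<subseteq> X" "word_prod g u ys = h a"
    using X into[OF a] unfolding free_basis_def by blast
  have sM: "set (map h_inv ys) \<subseteq> M" using ys XN h_inv_mem by auto
  have "map h (map h_inv ys) = ys" using ys(1) XN h_h_inv by (induction ys) auto
  then have "h (word_prod f e (map h_inv ys)) = h a" using h_word_prod[OF sM] ys by simp
  then have "word_prod f e (map h_inv ys) = a" using inj word_prod_mem[OF sM] a by (meson inj_on_def)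
  moreover have "set (map h_inv ys) \<subseteq> h_inv ` X" using ys by auto
  ultimately show "\<exists>!xs. set xs \<subseteq> h_inv ` X \<and> word_prod f e xs = a" using words_eq by blast
qed

lemma free: "free_monoid N g u \<Longrightarrow> free_monoid M f e"
  unfolding free_monoid_def using monoid free_basis by blast

lemma infinitely_generated: assumes "infinitely_generated N g u" shows "infinitely_generated M f e"
  unfolding infinitely_generated_def
proof
  assume "\<exists>F. finite F \<and> generates M f e F"
  then obtain F where F: "finite F" "generates M f e F" by blast
  have "generates N g u (h ` F)" unfolding generates_def
  proof (intro conjI ballI)
    show "h ` F \<subseteq> N" using F(2) into unfolding generates_def by blast
    fix b assume b: "b \<in> N"
    obtain xs where xs: "set xs \<subseteq> F" "word_prod f e xs = h_inv b"
      using F(2) h_inv_mem[OF b] unfolding generates_def by blast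
    have "set xs \<subseteq> M" using xs F(2) unfolding generates_def by blast
    then have "word_prod g u (map h xs) = b" using h_word_prod[of xs] xs(2) h_h_inv[OF b] by simp
    then show "\<exists>xs. set xs \<subseteq> h ` F \<and> word_prod g u xs = b" using xs(1) by (intro exI[of _ "map h xs"]) auto
  qed
  then show False using assms F(1) unfolding infinitely_generated_def by blast
qed

lemma noncomm: assumes "\<exists>a\<in>N. \<exists>b\<in>N. g a b \<noteq> g b a" shows "\<exists>a\<in>M. \<exists>b\<in>M. f a b \<noteq> f b a"
proof -
  obtain a b where ab: "a \<in> N" "b \<in> N" "g a b \<noteq> g b a" using assms by blast
  then have "h (f (h_inv a) (h_inv b)) \<noteq> h (f (h_inv b) (h_inv a))" using hom h_inv_mem h_h_inv by simp
  then have "f (h_inv a) (h_inv b) \<noteq> f (h_inv b) (h_inv a)" by metis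
  then show ?thesis using h_inv_mem ab by blast
qed

end

section \<open>Cayley digraphs of free monoids\<close>

text \<open>For a monoid with free basis X, the Cayley digraph (edges a -> a x, x in X) is a tree rooted
  at the unit: the parent of a vertex is obtained by deleting the last letter of its unique word.
  All out-neighbourhoods are equipotent to X.\<close>
locale free_monoid_cayley =
  fixes M :: "'a set" and f e X
  assumes mon: "is_monoid M f e" and basis: "free_basis M f e X"
begin

text \<open>The monoid axioms as separate facts.\<close>
lemma unit_mem: "e \<in> M" and closed: "a \<in> M \<Longrightarrow> b \<in> M \<Longrightarrow> f a b \<in> M"
  and unit_right: "a \<in> M \<Longrightarrow> f a e = a" and unit_left: "a \<in> M \<Longrightarrow> f e a = a"
  and assoc: "a \<in> M \<Longrightarrow> b \<in> M \<Longrightarrow> c \<in> M \<Longrightarrow> f (f a b) c = f a (f b c)"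
  using mon unfolding is_monoid_def by blast+

lemma basis_sub: "X \<subseteq> M" using basis unfolding free_basis_def by blast

lemma word_prod_mem: "set xs \<subseteq> M \<Longrightarrow> word_prod f e xs \<in> M"
  by (induction xs) (auto simp: unit_mem closed)

text \<open>Appending a letter multiplies on the right.\<close>
lemma word_prod_snoc: "set xs \<subseteq> M \<Longrightarrow> x \<in> M \<Longrightarrow> word_prod f e (xs @ [x]) = f (word_prod f e xs) x"
  by (induction xs) (simp_all add: unit_left unit_right assoc word_prod_mem)

text \<open>Existence and uniqueness of the word of an element.\<close>
lemma word_exists: "a \<in> M \<Longrightarrow> \<exists>xs. set xs \<subseteq> X \<and> word_prod f e xs = a"
  using basis unfolding free_basis_def by blast

lemma word_unique: "set xs \<subseteq> X \<Longrightarrow> set ys \<subseteq> X \<Longrightarrow> word_prod f e xs = word_prod f e ys \<Longrightarrow> xs = ys"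
  using basis word_prod_mem basis_sub unfolding free_basis_def by (metis subset_trans)

abbreviation "E \<equiv> cayley_edges M f X"

lemma edge_iff: "(a, b) \<in> E \<longleftrightarrow> (\<exists>x. a \<in> M \<and> x \<in> X \<and> b = f a x)"
  unfolding cayley_edges_def by auto

text \<open>Appending a letter to a word moves one step along an edge.\<close>
lemma edge_snoc: assumes "set xs \<subseteq> X" "x \<in> X" shows "(word_prod f e xs, word_prod f e (xs @ [x])) \<in> E"
proof -
  have "set xs \<subseteq> M" "x \<in> M" using assms basis_sub by auto
  then show ?thesis unfolding edge_iff using assms(2)
    by (intro exI[of _ x]) (simp add: word_prod_snoc word_prod_mem)
qed

text \<open>Every vertex is reachable from the root along its word.\<close>
lemma reachable: "set xs \<subseteq> X \<Longrightarrow> (e, word_prod f e xs) \<in> E\<^sup>*"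
proof (induction xs rule: rev_induct)
  case (snoc x xs) then show ?case using edge_snoc[of xs x] by (auto intro: rtrancl_into_rtrancl)
qed simp

text \<open>Every edge into w comes from deleting the last letter of the word of w.\<close>
lemma edge_into: assumes "(v, w) \<in> E"
  obtains vs x where "set vs \<subseteq> X" "x \<in> X" "v = word_prod f e vs" "w = word_prod f e (vs @ [x])"
proof -
  obtain x where h: "v \<in> M" "x \<in> X" "w = f v x" using assms edge_iff by blast
  obtain vs where vs: "set vs \<subseteq> X" "word_prod f e vs = v" using word_exists h(1) by blast
  have "set vs \<subseteq> M" "x \<in> M" using vs(1) h(2) basis_sub by auto
  then have "w = word_prod f e (vs @ [x])" using word_prod_snoc vs(2) h(3) by simp
  then show thesis using that vs h by blast
qed

lemma rooted_tree: "rooted_tree M E e"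
  unfolding rooted_tree_def
proof (intro conjI ballI allI impI)
  show "e \<in> M" by (rule unit_mem)
  show "E \<subseteq> M \<times> M" unfolding cayley_edges_def using closed basis_sub by blast
  show "(e, v) \<in> E\<^sup>*" if "v \<in> M" for v using word_exists[OF that] reachable by blast
  show "(v, e) \<notin> E" for v
  proof
    assume "(v, e) \<in> E"
    then obtain vs x where "set vs \<subseteq> X" "x \<in> X" "e = word_prod f e (vs @ [x])" by (rule edge_into)
    then have "vs @ [x] = []" using word_unique[of "vs @ [x]" "[]"] by simp
    then show False by simp
  qed
  fix w assume w: "w \<in> M" "w \<noteq> e"
  obtain ws where ws: "set ws \<subseteq> X" "word_prod f e ws = w" using word_exists w(1) by blast
  then obtain vs x where vx: "ws = vs @ [x]" using w(2) by (cases ws rule: rev_cases) auto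
  show "\<exists>!v. (v, w) \<in> E"
  proof (rule ex1I[of _ "word_prod f e vs"])
    show "(word_prod f e vs, w) \<in> E" using edge_snoc[of vs x] ws vx by auto
  next
    fix v assume "(v, w) \<in> E"
    then obtain us y where "set us \<subseteq> X" "y \<in> X" "v = word_prod f e us" "w = word_prod f e (us @ [y])"
      by (rule edge_into)
    then show "v = word_prod f e vs" using word_unique[of "us @ [y]" ws] ws vx by auto
  qed
qed

text \<open>The out-neighbours of v are the products v x, x in X.\<close>
lemma out_nbrs_eq: "v \<in> M \<Longrightarrow> out_nbrs E v = f v ` X"
  unfolding out_nbrs_def using edge_iff by auto

text \<open>Right multiplication by distinct basis elements gives distinct vertices.\<close>
lemma out_nbrs_eqpoll: assumes v: "v \<in> M" shows "X \<approx> out_nbrs E v"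
proof -
  have "inj_on (f v) X"
  proof
    fix x y assume xy: "x \<in> X" "y \<in> X" "f v x = f v y"
    obtain vs where vs: "set vs \<subseteq> X" "word_prod f e vs = v" using word_exists v by blast
    have "set vs \<subseteq> M" "x \<in> M" "y \<in> M" using vs(1) xy(1,2) basis_sub by auto
    then have "word_prod f e (vs @ [x]) = word_prod f e (vs @ [y])"
      using word_prod_snoc vs(2) xy(3) by simp
    then have "vs @ [x] = vs @ [y]" using word_unique[of "vs @ [x]" "vs @ [y]"] vs xy by simp
    then show "x = y" by simp
  qed
  then show ?thesis unfolding eqpoll_def using out_nbrs_eq[OF v] by (metis inj_on_imp_bij_betw)
qed

text \<open>Hence all out-degrees are equal (as cardinals) ...\<close>
lemma regular: "regular_digraph M E"
  unfolding regular_digraph_def by (metis out_nbrs_eqpoll eqpoll_sym eqpoll_trans)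

text \<open>... and infinite when the monoid is infinitely generated.\<close>
lemma basis_infinite: "infinitely_generated M f e \<Longrightarrow> infinite X"
proof
  assume "infinitely_generated M f e" "finite X"
  moreover have "generates M f e X" unfolding generates_def using basis_sub word_exists by blast
  ultimately show False unfolding infinitely_generated_def by blast
qed

lemma out_nbrs_infinite: "infinite X \<Longrightarrow> v \<in> M \<Longrightarrow> infinite (out_nbrs E v)"
  using out_nbrs_eqpoll eqpoll_finite_iff by blast

lemma vertices_infinite: "infinite X \<Longrightarrow> infinite M" using basis_sub finite_subset by blast

end

section \<open>The monoid C2\<close>

text \<open>C(1,1) is the class of orthogonal well-rounded lattices.\<close>
lemma Cls_1_1: "Cls 1 1 = {L \<in> WR_Z2. lattice_theta L = pi / 2}"
proof -
  have "sin (lattice_theta L) = 1 \<longleftrightarrow> lattice_theta L = pi / 2" if L: "L \<in> WR_Z2" for L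
  proof -
    interpret wr_sublattice L by unfold_locales (rule L)
    obtain x where x: "0 \<le> x" "2 * x < 1" "lattice_theta L = arccos x" using theta_arccos by blast
    then have b: "-1 \<le> x" "x \<le> 1" by auto
    have "sin (lattice_theta L) = sqrt (1 - x^2)" using x(3) sin_arccos[OF b] by simp
    moreover have "arccos x = pi / 2 \<longleftrightarrow> x = 0" using cos_arccos[OF b] by (metis arccos_0 cos_pi_half)
    ultimately show ?thesis using x(3) by simp
  qed
  then show ?thesis unfolding Cls_def by auto
qed

lemma Cls_1_1_mem: "Cls 1 1 \<in> C2" unfolding C2_def S_pairs_def by blast

text \<open>The map phi psi of the theorem.\<close>
definition Phi :: "(real \<times> real) set set \<Rightarrow> int ^ 3 ^ 3" where "Phi = phi \<circ> psi"

lemma Phi_bij: "bij_betw Phi C2 H'"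
  unfolding Phi_def using bij_betw_trans[OF psi_bij phi_bij] .

text \<open>Phi sends the unit C(1,1) to the identity matrix.\<close>
lemma Phi_one: "Phi (Cls 1 1) = mat 1"
proof -
  have "psi (Cls 1 1) = (1,0,1)" using psi_Cls[of 1 1] unfolding S_pairs_def psi_triple_def by simp
  then show ?thesis using phi_eval[OF mat1_H'] by (simp add: Phi_def unvec3_vec3)
qed

text \<open>By construction of *, Phi turns * into matrix multiplication.\<close>
lemma cstar_hom: assumes a: "a \<in> C2" and b: "b \<in> C2"
  shows "cstar a b \<in> C2" "Phi (cstar a b) = Phi a ** Phi b"
proof -
  have inj: "inj_on psi C2" and img: "psi ` C2 = PP" using psi_bij by (auto simp: bij_betw_def)
  let ?M = "Phi a ** Phi b"
  have M: "?M \<in> H'" using H'_mult_closed Phi_bij a b bij_betwE by blast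
  let ?t = "unvec3 (?M *v vec3 (1,0,1))"
  have t: "?t \<in> psi ` C2" using H'_image_in_PP[OF M] img by simp
  have c: "cstar a b = the_inv_into C2 psi ?t" unfolding cstar_def Phi_def by simp
  show "cstar a b \<in> C2" unfolding c using the_inv_into_into[OF inj t] by blast
  have "psi (cstar a b) = ?t" unfolding c using f_the_inv_into_f[OF inj t] .
  then show "Phi (cstar a b) = ?M" using phi_eval[OF M] by (simp add: Phi_def)
qed

text \<open>The composite of Phi with the inverse of word_mat identifies C2 with the word monoid.\<close>
definition to_words :: "(real \<times> real) set set \<Rightarrow> berggren list" where
  "to_words a = inv word_mat (Phi a)"

lemma to_words_bij: "bij_betw to_words C2 word_monoid"
proof -
  have "bij_betw (inv word_mat) H' word_monoid"
    unfolding H'_eq_word_monoid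
  proof (rule bij_betw_imageI)
    show "inj_on (inv word_mat) (word_mat ` word_monoid)" by (rule inj_on_inv_into) auto
    show "inv word_mat ` word_mat ` word_monoid = word_monoid" using word_mat_inj by (simp add: image_image)
  qed
  then show ?thesis unfolding to_words_def using bij_betw_trans[OF Phi_bij] by (simp add: comp_def)
qed

text \<open>to_words is a monoid isomorphism onto the word monoid.\<close>
lemma to_words_hom: assumes "a \<in> C2" "b \<in> C2" shows "to_words (cstar a b) = to_words a @ to_words b"
proof -
  have "Phi a \<in> range word_mat" "Phi b \<in> range word_mat"
    using assms Phi_bij H'_eq_word_monoid bij_betwE by blast+
  then have "Phi a ** Phi b = word_mat (to_words a @ to_words b)"
    unfolding to_words_def by (simp add: word_mat_append f_inv_into_f)
  then show ?thesis unfolding to_words_def cstar_hom(2)[OF assms] using word_mat_inj by simp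
qed

lemma to_words_one: "to_words (Cls 1 1) = []"
  unfolding to_words_def Phi_one using word_mat_inj inv_f_f[of word_mat "[]"] by simp

text \<open>Hence C2 inherits all properties of the word monoid.\<close>
interpretation C2_words: monoid_transport C2 cstar "Cls 1 1" word_monoid "(@)" "[]" to_words
  by unfold_locales (use to_words_bij to_words_one Cls_1_1_mem cstar_hom to_words_hom in auto)

lemma C2_monoid: "is_monoid C2 cstar (Cls 1 1)"
  using C2_words.monoid words.is_monoid .

lemma C2_free: "free_monoid C2 cstar (Cls 1 1)"
  using C2_words.free words.is_monoid words.free_basis_atoms unfolding free_monoid_def by blast

lemma C2_noncomm: "\<exists>a\<in>C2. \<exists>b\<in>C2. cstar a b \<noteq> cstar b a"
  using C2_words.noncomm word_monoid_noncomm .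

lemma C2_infinitely_generated: "infinitely_generated C2 cstar (Cls 1 1)"
  using C2_words.infinitely_generated words.infinitely_generated infinite_atoms by blast

text \<open>Phi is a monoid isomorphism onto H'.\<close>
lemma Phi_iso: "monoid_iso C2 cstar (Cls 1 1) H' (**) (mat 1) (phi \<circ> psi)"
  unfolding monoid_iso_def using Phi_bij Phi_one cstar_hom(2) by (simp add: Phi_def)

theorem theorem1p1:
  shows "bij_betw psi C2 PP
    \<and> (\<forall>t\<in>PP. \<exists>!M. M \<in> H' \<and> M *v vec3 (1, 0, 1) = vec3 t)
    \<and> bij_betw phi PP H'
    \<and> is_monoid C2 cstar (Cls 1 1)
    \<and> free_monoid C2 cstar (Cls 1 1)
    \<and> (\<exists>a\<in>C2. \<exists>b\<in>C2. cstar a b \<noteq> cstar b a)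
    \<and> infinitely_generated C2 cstar (Cls 1 1)
    \<and> Cls 1 1 = {L \<in> WR_Z2. lattice_theta L = pi / 2}
    \<and> monoid_iso C2 cstar (Cls 1 1) H' (**) (mat 1) (phi \<circ> psi)
    \<and> (\<forall>X. free_basis C2 cstar (Cls 1 1) X \<longrightarrow>
          rooted_tree C2 (cayley_edges C2 cstar X) (Cls 1 1)
          \<and> infinite C2
          \<and> regular_digraph C2 (cayley_edges C2 cstar X)
          \<and> (\<forall>v\<in>C2. infinite (out_nbrs (cayley_edges C2 cstar X) v)))"
proof (intro conjI allI impI ballI)
  fix X assume X: "free_basis C2 cstar (Cls 1 1) X"
  interpret cayley: free_monoid_cayley C2 cstar "Cls 1 1" X by unfold_locales (rule C2_monoid, rule X)
  have "infinite X" using cayley.basis_infinite C2_infinitely_generated .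
  then show "infinite C2" "\<And>v. v \<in> C2 \<Longrightarrow> infinite (out_nbrs (cayley_edges C2 cstar X) v)"
    using cayley.vertices_infinite cayley.out_nbrs_infinite by blast+
  show "rooted_tree C2 (cayley_edges C2 cstar X) (Cls 1 1)" "regular_digraph C2 (cayley_edges C2 cstar X)"
    using cayley.rooted_tree cayley.regular .
qed (use psi_bij H'_unique_matrix phi_bij C2_monoid C2_free C2_noncomm C2_infinitely_generated
    Cls_1_1 Phi_iso in auto)

end
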